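(* Let $f_1,\dots,f_n:\mathbb{R}^p\to\mathbb{R}$ be twice differentiable and $F(\mathbf{x})=\frac1n\sum_{i=1}^n f_i(\mathbf{x})$. Assume that there are constants $0<K_i<\infty$ with $0\preceq\nabla^2 f_i(\mathbf{x})\preceq K_i\mathbb{I}$ for all $\mathbf{x}\in\mathbb{R}^p$ and $i=1,\dots,n$, and constants $0<\gamma\le K<\infty$ with $\gamma\mathbb{I}\preceq\nabla^2F(\mathbf{x})\preceq K\mathbb{I}$ for all $\mathbf{x}\in\mathbb{R}^p$; let $\mathbf{x}^*$ be the minimizer of $F$. Let $0<\epsilon<1$, $0<\delta<1$, $0<\theta_2<1$, $0<\beta<1$, $\widehat\alpha\ge1$ be given. For any $\mathbf{x}^{(k)}\in\mathbb{R}^p$, let $\mathbf{x}^{(k+1)}$ be obtained from $\mathbf{x}^{(k)}$ by one iteration of the spectrally regularized sub-sampled Newton algorithm described in the context, with $\mathcal{S}$ drawn uniformly at random without replacement with $|\mathcal{S}|\ge 2\kappa_1\ln(p/\delta)/\epsilon^2$, and inexact update with tolerances $\theta_1^{(k)},\theta_2$. If $$\theta_1^{(k)}\le\frac12\sqrt{\frac{\lambda^{(k)}}{\max\{\lambda^{(k)},\widehat K_{|\mathcal{S}|}\}}},$$ then $$F(\mathbf{x}^{(k+1)})-F(\mathbf{x}^* )\le(1-\rho)\big(F(\mathbf{x}^{(k)})-F(\mathbf{x}^* )\big),\qquad\rho=\frac{\alpha_k\beta\gamma}{\max\{\widehat K_{|\mathcal{S}|},\lambda^{(k)}\}}.$$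 Moreover, with probability $1-\delta$, the step size is at least $$\alpha_k\ge\frac{2(1-\theta_2)(1-\beta)(1-\epsilon)}{\kappa}.$$
   Context: $\kappa=K/\gamma$. For an integer $1\le q\le n$, $\widehat K_q$ is the average of the $q$ largest values among $K_1,\dots,K_n$, and $\kappa_q=\widehat K_q/\gamma$. Spectral regularization: for $\lambda\ge0$ and a symmetric matrix $H\in\mathbb{R}^{p\times p}$ with orthonormal eigenvectors $\mathbf{v}_i$ and eigenvalues $\lambda_i(H)$, $\mathcal{P}(\lambda;H)=\sum_{i=1}^p\max\{\lambda_i(H),\lambda\}\mathbf{v}_i\mathbf{v}_i^T$ (equivalently $\lambda\mathbb{I}+\arg\min_{X\succeq0}\|H-\lambda\mathbb{I}-X\|_F$). Algorithm (one iteration). Draw $\mathcal{S}$ from $\{1,\dots,n\}$ and set $H(\mathbf{x}^{(k)})=\frac1{|\mathcal{S}|}\sum_{j\in\mathcal{S}}\nabla^2f_j(\mathbf{x}^{(k)})$. Choose any $\lambda^{(k)}>\lambda_{\min}(H(\mathbf{x}^{(k)}))$ and set $\hat H(\mathbf{x}^{(k)})=\mathcal{P}(\lambda^{(k)};H(\mathbf{x}^{(k)}))$. Then $\mathbf{x}^{(k+1)}=\mathbf{x}^{(k)}+\alpha_k\mathbf{p}_k$, where, for a tolerance $\theta_1^{(k)}\ge0$, $\mathbf{p}_k$ is any vector satisfying both $$\|\hat H(\mathbf{x}^{(k)})\mathbf{p}_k+\nabla F(\mathbf{x}^{(k)})\|\le\theta_1^{(k)}\|\nabla F(\mathbf{x}^{(k)})\|,\qquad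 \mathbf{p}_k^T\nabla F(\mathbf{x}^{(k)})\le-(1-\theta_2)\,\mathbf{p}_k^T\hat H(\mathbf{x}^{(k)})\mathbf{p}_k,$$ and $\alpha_k$ is the largest $\alpha\le\widehat\alpha$ such that $F(\mathbf{x}^{(k)}+\alpha\mathbf{p}_k)\le F(\mathbf{x}^{(k)})+\alpha\beta\,\mathbf{p}_k^T\nabla F(\mathbf{x}^{(k)})$. "With probability $1-\delta$" means with probability at least $1-\delta$ over the draw of $\mathcal{S}$. $A\preceq B$ means $B-A$ is symmetric positive semi-definite.
   Formalization: The step-size bound is proved as α_k ≥ min{α̂, 2(1−θ₂)(1−β)(1−ε)/κ}; the printed bound fails when its right side exceeds α̂, since α_k ≤ α̂ by construction, and is unchanged otherwise. *)

theory Defs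
  imports "HOL-Probability.Probability"
begin

definition grad :: "(real^'p \<Rightarrow> real) \<Rightarrow> real^'p \<Rightarrow> real^'p" where
  "grad f x = (THE D. GDERIV f x :> D)"

definition hessian :: "(real^'p \<Rightarrow> real) \<Rightarrow> real^'p \<Rightarrow> real^'p^'p" where
  "hessian f x = jacobian (grad f) (at x)"

definition twice_differentiable :: "(real^'p \<Rightarrow> real) \<Rightarrow> bool" where
  "twice_differentiable f \<longleftrightarrow>
     (\<forall>x. f differentiable (at x)) \<and> (\<forall>x. grad f differentiable (at x))"

(* Symmetry is part of the definition: over the reals it does not follow from
   nonnegativity of the quadratic form. *)
definition psd :: "real^'p^'p \<Rightarrow> bool" where
  "psd A \<longleftrightarrow> transpose A = A \<and> (\<forall>v. 0 \<le> v \<bullet> (A *v v))"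

definition loewner_le :: "real^'p^'p \<Rightarrow> real^'p^'p \<Rightarrow> bool"  (infix "\<preceq>" 50) where
  "A \<preceq> B \<longleftrightarrow> psd (B - A)"

definition eigenvalues :: "real^'p^'p \<Rightarrow> real set" where
  "eigenvalues A = {\<mu>. \<exists>v. v \<noteq> 0 \<and> A *v v = \<mu> *\<^sub>R v}"

definition lambda_min :: "real^'p^'p \<Rightarrow> real" where
  "lambda_min A = Min (eigenvalues A)"

definition outer :: "real^'p \<Rightarrow> real^'p \<Rightarrow> real^'p^'p" where
  "outer u v = (columnvector u :: real^1^'p) ** (rowvector v :: real^'p^1)"

(* The p-element type 'p serves as the index set of the eigenbasis.  For symmetric H a
   basis exists and the resulting matrix does not depend on which one is chosen. *)
definition spectral_reg :: "real \<Rightarrow> real^'p^'p \<Rightarrow> real^'p^'p" where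
  "spectral_reg l H = (SOME X. \<exists>(v :: 'p \<Rightarrow> real^'p) (\<mu> :: 'p \<Rightarrow> real).
      (\<forall>i j. v i \<bullet> v j = (if i = j then 1 else 0)) \<and>
      (\<forall>i. H *v v i = \<mu> i *\<^sub>R v i) \<and>
      X = (\<Sum>i\<in>UNIV. max (\<mu> i) l *\<^sub>R outer (v i) (v i)))"

(* Average of the q largest among c 1, ..., c n, counted with multiplicity. *)
definition top_avg :: "nat \<Rightarrow> (nat \<Rightarrow> real) \<Rightarrow> nat \<Rightarrow> real" where
  "top_avg n c q = sum_list (take q (rev (sort (map c [1..<Suc n])))) / real q"

definition sub_hessian ::
    "(nat \<Rightarrow> real^'p \<Rightarrow> real) \<Rightarrow> nat set \<Rightarrow> real^'p \<Rightarrow> real^'p^'p" where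
  "sub_hessian f S x = (1 / real (card S)) *\<^sub>R (\<Sum>j\<in>S. hessian (f j) x)"

definition samples :: "nat \<Rightarrow> nat \<Rightarrow> nat set set" where
  "samples n s = {S. S \<subseteq> {1..n} \<and> card S = s}"

definition armijo ::
    "(real^'p \<Rightarrow> real) \<Rightarrow> real \<Rightarrow> real^'p \<Rightarrow> real^'p \<Rightarrow> real \<Rightarrow> bool" where
  "armijo F \<beta> x d \<alpha> \<longleftrightarrow> F (x + \<alpha> *\<^sub>R d) \<le> F x + \<alpha> * \<beta> * (d \<bullet> grad F x)"

(* One iteration from x with sample S.  The algorithm leaves the threshold l, the
   tolerance \<theta>\<^sub>1 and the direction d partly free, so an iteration is a relation:
   it holds when l, \<theta>\<^sub>1, d, \<alpha>, x' are admissible. *)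
definition newton_iteration ::
    "(nat \<Rightarrow> real^'p \<Rightarrow> real) \<Rightarrow> (real^'p \<Rightarrow> real) \<Rightarrow> real \<Rightarrow> real \<Rightarrow> real \<Rightarrow>
     real^'p \<Rightarrow> nat set \<Rightarrow> real \<Rightarrow> real \<Rightarrow> real^'p \<Rightarrow> real \<Rightarrow> real^'p \<Rightarrow> bool" where
  "newton_iteration f F \<theta>\<^sub>2 \<beta> \<alpha>max x S l \<theta>\<^sub>1 d \<alpha> x' \<longleftrightarrow>
     (let H = sub_hessian f S x; Hreg = spectral_reg l H; g = grad F x in
        l > lambda_min H \<and>
        \<theta>\<^sub>1 \<ge> 0 \<and>
        norm (Hreg *v d + g) \<le> \<theta>\<^sub>1 * norm g \<and>
        d \<bullet> g \<le> - (1 - \<theta>\<^sub>2) * (d \<bullet> (Hreg *v d)) \<and>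
        \<alpha> \<le> \<alpha>max \<and> armijo F \<beta> x d \<alpha> \<and> (\<forall>a\<le>\<alpha>max. armijo F \<beta> x d a \<longrightarrow> a \<le> \<alpha>) \<and>
        x' = x + \<alpha> *\<^sub>R d)"

end

theory Submission
  imports Defs "HOL-Real_Asymp.Real_Asymp"
begin

text \<open>
  Step size: it suffices that the sub-sampled Hessian dominates \<open>(1 - \<epsilon>) \<gamma>\<close>, which follows
  from a lower-tail matrix Chernoff bound for sums sampled without replacement. By Markov's
  inequality one has to bound the mean of \<open>tr exp (- \<Sum>\<^sub>S X\<^sub>j)\<close>. A summand with
  \<open>0 \<preceq> X \<preceq> R\<close> satisfies
  \<open>tr exp (- A - X) \<le> tr exp (- A) - c tr (X exp (- A))\<close> with \<open>c = (1 - exp (- R)) / R\<close>.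
  The right-hand side is affine in \<open>X\<close>, so averaging over the last draw multiplies the mean by
  at most \<open>1 - c \<gamma>\<close>; a draw without replacement is compared with an independent one by
  convexity of the trace exponential. Neither the Golden--Thompson inequality nor Lieb's
  theorem is needed: expanding in the eigenbases of \<open>A\<close> and \<open>A + X\<close> simultaneously
  reduces the trace inequalities to scalar ones.

  Rate: the spectrum of the regularized Hessian lies between \<open>\<lambda>\<close> and the maximum \<open>L\<close> of
  \<open>\<lambda>\<close> and the average of the largest \<open>K\<^sub>i\<close>. In its eigenbasis the residual bound gives
  \<open>- p\<^sup>T g \<ge> \<parallel>g\<parallel>\<^sup>2 / 2L\<close> for the gradient \<open>g\<close> of \<open>F\<close>; combine this with the
  sufficient decrease condition and the Polyak--Lojasiewicz inequality.
\<close>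

subsection \<open>Symmetric matrices\<close>

lemma symmetric_dot:
  fixes A :: "real^'n^'n"
  assumes "transpose A = A"
  shows "x \<bullet> (A *v y) = (A *v x) \<bullet> y"
  by (metis assms dot_lmul_matrix transpose_matrix_vector)

lemma transpose_sum: "transpose (\<Sum>i\<in>I. X i) = (\<Sum>i\<in>I. transpose (X i))"
  by (simp add: transpose_def vec_eq_iff sum_component)

lemma transpose_add: "transpose (A + B) = transpose A + transpose B"
  by (simp add: transpose_def vec_eq_iff)

lemma sum_matrix_vector_mult:
  fixes X :: "'i \<Rightarrow> real^'n^'m"
  shows "(\<Sum>i\<in>I. X i) *v y = (\<Sum>i\<in>I. X i *v y)"
  by (induction I rule: infinite_finite_induct) (simp_all add: matrix_vector_mult_add_rdistrib)

lemma continuous_on_matrix_vector_mult: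
  fixes A :: "real^'n^'m"
  shows "continuous_on S ((*v) A)"
  by (simp add: linear_continuous_on linear_linear)

subsection \<open>Eigensystems\<close>

definition eigensystem :: "real^'n^'n \<Rightarrow> ('n \<Rightarrow> real^'n) \<Rightarrow> ('n \<Rightarrow> real) \<Rightarrow> bool" where
  "eigensystem A v \<mu> \<longleftrightarrow>
     (\<forall>i j. v i \<bullet> v j = (if i = j then 1 else 0)) \<and> (\<forall>i. A *v v i = \<mu> i *\<^sub>R v i)"

lemma eigensystemD:
  assumes "eigensystem A v \<mu>"
  shows "v i \<bullet> v j = (if i = j then 1 else 0)" "A *v v i = \<mu> i *\<^sub>R v i"
  using assms by (auto simp: eigensystem_def)

text \<open>The residual \<open>w\<close> of the eigenvalue equation lies in \<open>S\<close>
  itself, so maximality can be tested along \<open>v + t w\<close>. This yields 0 <= 2t |w|^2 + t^2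
  e for every real t, and a suitable negative t then rules out a nonzero \<open>w\<close>.\<close>

lemma maximizer_is_eigenvector:
  fixes A :: "real^'n^'n"
  assumes A: "transpose A = A" and S: "subspace S" and inv: "\<And>w. w \<in> S \<Longrightarrow> A *v w \<in> S"
    and v: "v \<in> S" "v \<bullet> v = 1" and max: "\<And>w. w \<in> S \<Longrightarrow> w \<bullet> (A *v w) \<le> m * (w \<bullet> w)"
    and m: "m = v \<bullet> (A *v v)"
  shows "A *v v = m *\<^sub>R v"
proof -
  define w where "w = m *\<^sub>R v - A *v v"
  have wS: "w \<in> S" unfolding w_def by (intro subspace_diff subspace_scale S inv v)
  define e where "e = m * (w \<bullet> w) - w \<bullet> (A *v w)"
  have e: "e \<ge> 0" unfolding e_def using max[OF wS] by simp
  have *: "0 \<le> 2 * t * (w \<bullet> w) + t\<^sup>2 * e" for t :: real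
  proof -
    have "v + t *\<^sub>R w \<in> S" by (intro subspace_add subspace_scale S v wS)
    from max[OF this] have
      "(v + t *\<^sub>R w) \<bullet> (A *v (v + t *\<^sub>R w)) \<le> m * ((v + t *\<^sub>R w) \<bullet> (v + t *\<^sub>R w))" .
    moreover have "v \<bullet> (A *v w) = w \<bullet> (A *v v)" "v \<bullet> w = w \<bullet> v"
      using symmetric_dot[OF A, of v w] by (simp_all add: inner_commute)
    then have "(v + t *\<^sub>R w) \<bullet> (A *v (v + t *\<^sub>R w)) =
        m + 2 * t * (w \<bullet> (A *v v)) + t\<^sup>2 * (w \<bullet> (A *v w))"
      and "(v + t *\<^sub>R w) \<bullet> (v + t *\<^sub>R w) = 1 + 2 * t * (w \<bullet> v) + t\<^sup>2 * (w \<bullet> w)"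
      by (simp_all add: matrix_vector_right_distrib matrix_vector_mult_scaleR inner_add_left
          inner_add_right v m[symmetric] power2_eq_square) (simp_all add: algebra_simps)
    moreover have ww: "w \<bullet> w = m * (w \<bullet> v) - w \<bullet> (A *v v)"
      by (subst (2) w_def) (simp add: inner_diff_right)
    ultimately have "2 * t * (w \<bullet> (A *v v)) + t\<^sup>2 * (w \<bullet> (A *v w))
        \<le> m * (2 * t * (w \<bullet> v)) + m * (t\<^sup>2 * (w \<bullet> w))"
      by (simp add: distrib_left)
    moreover have "m * (2 * t * (w \<bullet> v)) - 2 * t * (w \<bullet> (A *v v)) = 2 * t * (w \<bullet> w)"
      by (subst ww) (simp add: algebra_simps)
    ultimately show ?thesis by (simp add: e_def algebra_simps)
  qed
  have "w \<bullet> w \<le> 0"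
  proof (rule ccontr)
    assume "\<not> w \<bullet> w \<le> 0"
    then have c: "w \<bullet> w > 0" by (simp only: not_le)
    \<comment> \<open>The summand 1 keeps the denominator positive even if \<open>e\<close>
      vanishes.\<close>
    define t where "t = - (w \<bullet> w) / (e + 1)"
    have w: "w \<bullet> w = - t * (e + 1)" using e by (simp add: t_def)
    have "2 * t * (w \<bullet> w) + t\<^sup>2 * e = - (t\<^sup>2 * (e + 2))"
      unfolding w by (simp add: algebra_simps power2_eq_square)
    also have "\<dots> < 0" using c e by (auto simp: t_def)
    finally show False using *[of t] by simp
  qed
  then have "w = 0" by (metis inner_ge_zero inner_eq_zero_iff order_antisym)
  then show ?thesis by (simp add: w_def)
qed

text \<open>The quadratic form attains its maximum on the compact unit sphere of \<open>S\<close>,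
  and homogeneity carries the bound over to all of \<open>S\<close>.\<close>

lemma eigenvector_in_subspace:
  fixes A :: "real^'n^'n"
  assumes A: "transpose A = A" and S: "subspace S" and inv: "\<And>w. w \<in> S \<Longrightarrow> A *v w \<in> S"
    and ne: "z \<in> S" "z \<noteq> 0"
  obtains v m where "v \<in> S" "v \<bullet> v = 1" "A *v v = m *\<^sub>R v"
proof -
  have cpt: "compact (S \<inter> sphere 0 1)"
    by (intro closed_Int_compact closed_subspace S) auto
  have "z /\<^sub>R norm z \<in> S \<inter> sphere 0 1" using ne S by (auto simp: subspace_scale)
  then have ne': "S \<inter> sphere 0 1 \<noteq> {}" by blast
  have "continuous_on (S \<inter> sphere 0 1) (\<lambda>w. w \<bullet> (A *v w))"
    by (intro continuous_intros continuous_on_matrix_vector_mult)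
  from continuous_attains_sup[OF cpt ne' this] obtain v where v: "v \<in> S" "norm v = 1"
    and max: "\<And>w. w \<in> S \<Longrightarrow> norm w = 1 \<Longrightarrow> w \<bullet> (A *v w) \<le> v \<bullet> (A *v v)" by auto
  have max': "w \<bullet> (A *v w) \<le> (v \<bullet> (A *v v)) * (w \<bullet> w)" if "w \<in> S" for w
  proof (cases "w = 0")
    case False
    have "(w /\<^sub>R norm w) \<bullet> (A *v (w /\<^sub>R norm w)) \<le> v \<bullet> (A *v v)"
      using that False S by (intro max) (auto simp: subspace_scale)
    then show ?thesis using False
      by (simp add: matrix_vector_mult_scaleR dot_square_norm field_simps power2_eq_square)
  qed simp
  have "v \<bullet> v = 1" using v by (simp add: dot_square_norm)
  with maximizer_is_eigenvector[OF A S inv v(1) _ max'] v that show thesis by blast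
qed

text \<open>Eigenvectors are collected one at a time: by symmetry the orthogonal complement of those
  already found is invariant, so it contains a further one. A bijection finally indexes them by
  \<open>'n\<close>.\<close>

theorem symmetric_eigensystem:
  fixes A :: "real^'n^'n"
  assumes A: "transpose A = A"
  obtains v \<mu> where "eigensystem A v \<mu>"
proof -
  have "\<exists>B. finite B \<and> card B = k \<and> (\<forall>x\<in>B. \<forall>y\<in>B. x \<bullet> y = (if x = y then 1 else 0)) \<and>
        (\<forall>x\<in>B. \<exists>m. A *v x = m *\<^sub>R x)" if "k \<le> CARD('n)" for k
    using that
  proof (induction k)
    case 0
    show ?case by (intro exI[of _ "{}"]) auto
  next
    case (Suc k)
    then obtain B where B: "finite B" "card B = k" "\<And>x y. x\<in>B \<Longrightarrow> y\<in>B \<Longrightarrow> x \<bullet> y = (if x = y then 1 else 0)"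
      "\<And>x. x \<in> B \<Longrightarrow> \<exists>m. A *v x = m *\<^sub>R x" by auto
    define S where "S = {w. \<forall>b\<in>B. b \<bullet> w = 0}"
    have S: "subspace S" unfolding S_def subspace_def by (auto simp: inner_add_right)
    have inv: "A *v w \<in> S" if "w \<in> S" for w
    proof -
      have "b \<bullet> (A *v w) = 0" if "b \<in> B" for b
        using B(4)[OF that] \<open>w \<in> S\<close> that by (auto simp: symmetric_dot[OF A] S_def)
      then show ?thesis by (simp add: S_def)
    qed
    have "dim B < DIM(real^'n)" using dim_le_card'[OF B(1)] B(2) Suc.prems by simp
    then obtain z where z: "z \<noteq> 0" "\<And>y. y \<in> span B \<Longrightarrow> orthogonal z y"
      using orthogonal_to_subspace_exists by metis
    then have "z \<in> S" by (auto simp: S_def orthogonal_def inner_commute span_base)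
    then obtain v m where v: "v \<in> S" "v \<bullet> v = 1" "A *v v = m *\<^sub>R v"
      using eigenvector_in_subspace[OF A S inv _ z(1)] by blast
    have "v \<notin> B" using v by (auto simp: S_def)
    then show ?case using B v
      by (intro exI[of _ "insert v B"] conjI ballI) (auto simp: S_def inner_commute)
  qed
  from this[of "CARD('n)"] obtain B where B: "finite B" "card B = CARD('n)"
      "\<And>x y. x\<in>B \<Longrightarrow> y\<in>B \<Longrightarrow> x \<bullet> y = (if x = y then 1 else 0)"
      "\<And>x. x \<in> B \<Longrightarrow> \<exists>m. A *v x = m *\<^sub>R x" by blast
  then obtain v :: "'n \<Rightarrow> real^'n" where v: "bij_betw v UNIV B"
    using finite_same_card_bij[of "UNIV :: 'n set" B] by auto
  from B(4) obtain m where m: "\<And>x. x \<in> B \<Longrightarrow> A *v x = m x *\<^sub>R x" by metis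
  have vinj: "inj v" using v by (simp add: bij_betw_def)
  have vB: "v i \<in> B" for i using v by (auto simp: bij_betw_def)
  have "eigensystem A v (\<lambda>i. m (v i))"
    unfolding eigensystem_def using B(3)[OF vB vB] m[OF vB] by (simp add: inj_eq[OF vinj])
  then show thesis by (rule that)
qed

text \<open>The transpose of the matrix with rows \<open>v i\<close> is a right inverse by
  orthonormality. The matrix being square, it is a left inverse too, so inner products are
  preserved.\<close>

lemma parseval:
  fixes A :: "real^'n^'n"
  assumes "eigensystem A v \<mu>"
  shows "x \<bullet> y = (\<Sum>i\<in>UNIV. (v i \<bullet> x) * (v i \<bullet> y))"
proof -
  define V where "V = (\<chi> i. v i)"
  have "V ** transpose V = mat 1"
    using eigensystemD(1)[OF assms]
    by (simp add: V_def matrix_matrix_mult_def transpose_def mat_def vec_eq_iff inner_vec_def)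
  then have *: "transpose V ** V = mat 1" by (simp add: matrix_left_right_inverse)
  have V: "(V *v z) $ i = v i \<bullet> z" for z i
    by (simp add: V_def matrix_vector_mult_def inner_vec_def)
  have "x \<bullet> y = x \<bullet> (transpose V *v (V *v y))"
    unfolding matrix_vector_mul_assoc * by simp
  also have "\<dots> = (V *v x) \<bullet> (V *v y)"
    by (metis dot_lmul_matrix transpose_transpose transpose_matrix_vector)
  finally show ?thesis by (simp add: inner_vec_def V)
qed

lemma eigensystem_dot:
  fixes A :: "real^'n^'n"
  assumes "eigensystem A v \<mu>"
  shows "v i \<bullet> (A *v y) = \<mu> i * (v i \<bullet> y)"
proof -
  have exp: "y = (\<Sum>j\<in>UNIV. (v j \<bullet> y) *\<^sub>R v j)" 
  proof (rule vector_eq_rdot[THEN iffD1], rule allI)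
    fix z
    show "y \<bullet> z = (\<Sum>j\<in>UNIV. (v j \<bullet> y) *\<^sub>R v j) \<bullet> z"
      by (subst parseval[OF assms]) (simp add: inner_sum_left)
  qed
  have "A *v y = (\<Sum>j\<in>UNIV. A *v ((v j \<bullet> y) *\<^sub>R v j))"
    by (subst exp) (simp add: linear_sum)
  then have "v i \<bullet> (A *v y) = (\<Sum>j\<in>UNIV. (v j \<bullet> y) * (\<mu> j * (v i \<bullet> v j)))"
    by (simp add: matrix_vector_mult_scaleR eigensystemD(2)[OF assms] inner_sum_right mult.assoc)
  also have "\<dots> = (\<Sum>j\<in>UNIV. if i = j then \<mu> i * (v i \<bullet> y) else 0)"
    by (intro sum.cong) (auto simp: eigensystemD[OF assms])
  finally show ?thesis by simp
qed

lemma eigensystem_norm: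
  assumes "eigensystem A v \<mu>"
  shows "(norm x)\<^sup>2 = (\<Sum>i\<in>UNIV. (v i \<bullet> x)\<^sup>2)"
  using parseval[OF assms, of x x] by (simp add: dot_square_norm power2_eq_square)

lemma eigensystem_quadratic:
  assumes "eigensystem A v \<mu>"
  shows "x \<bullet> (A *v x) = (\<Sum>i\<in>UNIV. \<mu> i * (v i \<bullet> x)\<^sup>2)"
  by (subst parseval[OF assms])
    (simp add: eigensystem_dot[OF assms] power2_eq_square mult_ac)

text \<open>This links the indexed family to the set whose minimum is \<open>lambda_min\<close>. An
  eigenvector has a nonzero coordinate along some \<open>v i\<close>, and comparing that coordinate
  before and after applying \<open>A\<close> identifies its eigenvalue.\<close>

lemma eigensystem_eigenvalues:
  fixes A :: "real^'n^'n"
  assumes "eigensystem A v \<mu>"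
  shows "eigenvalues A = range \<mu>"
proof (intro set_eqI iffI)
  fix m assume "m \<in> eigenvalues A"
  then obtain x where x: "x \<noteq> 0" "A *v x = m *\<^sub>R x" by (auto simp: eigenvalues_def)
  have "\<exists>i. v i \<bullet> x \<noteq> 0"
  proof (rule ccontr)
    assume "\<nexists>i. v i \<bullet> x \<noteq> 0"
    then have "(norm x)\<^sup>2 = 0" unfolding eigensystem_norm[OF assms] by simp
    then show False using x by simp
  qed
  then obtain i where i: "v i \<bullet> x \<noteq> 0" ..
  with eigensystem_dot[OF assms, of i x] x have "m = \<mu> i" by simp
  then show "m \<in> range \<mu>" by simp
next
  fix m assume "m \<in> range \<mu>"
  then obtain i where "m = \<mu> i" by auto
  moreover have "v i \<noteq> 0" using eigensystemD(1)[OF assms, of i i] by auto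
  ultimately show "m \<in> eigenvalues A"
    unfolding eigenvalues_def using eigensystemD(2)[OF assms] by blast
qed

lemma eigensystem_lambda_min_mem:
  assumes "eigensystem A v \<mu>"
  obtains i where "lambda_min A = \<mu> i"
proof -
  have "Min (range \<mu>) \<in> range \<mu>" by (rule Min_in) auto
  then show thesis
    using that unfolding lambda_min_def eigensystem_eigenvalues[OF assms] by blast
qed

section \<open>Quadratic forms and the Loewner order\<close>

lemma zero_loewner_le [simp]: "0 \<preceq> A \<longleftrightarrow> psd A"
  by (simp add: loewner_le_def)

lemma mat_mult_vector: "mat c *v v = c *\<^sub>R (v :: real^'n)"
  by (simp add: mat_def matrix_vector_mult_def vec_eq_iff if_distrib if_distribR cong: if_cong)

lemma psd_symmetric: "psd A \<Longrightarrow> transpose A = A"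
  by (simp add: psd_def)

lemma psd_nonneg: "psd A \<Longrightarrow> 0 \<le> v \<bullet> (A *v v)"
  by (simp add: psd_def)

lemma loewner_le_quadratic:
  assumes "A \<preceq> B"
  shows "v \<bullet> (A *v v) \<le> v \<bullet> (B *v v)"
  using assms psd_nonneg[of "B - A" v]
  by (simp add: loewner_le_def matrix_vector_mult_diff_rdistrib inner_diff_right)

lemma loewner_le_matD:
  "A \<preceq> mat c \<Longrightarrow> v \<bullet> (A *v v) \<le> c * (v \<bullet> v)"
  "mat c \<preceq> A \<Longrightarrow> c * (v \<bullet> v) \<le> v \<bullet> (A *v v)"
  using loewner_le_quadratic[of A "mat c" v] loewner_le_quadratic[of "mat c" A v]
  by (simp_all add: mat_mult_vector)

lemma eigensystem_value:
  assumes "eigensystem A v \<mu>"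
  shows "\<mu> i = v i \<bullet> (A *v v i)"
  using eigensystemD[OF assms] by simp

text \<open>The matrix form of m^2 <= R m for eigenvalues m in [0, R]. It absorbs the second-order
  terms in \<open>trexp_mult_decay\<close>.\<close>

lemma square_norm_le_of_psd:
  fixes X :: "real^'n^'n"
  assumes X: "psd X" and R: "\<And>v. v \<bullet> (X *v v) \<le> R * (v \<bullet> v)"
  shows "(X *v u) \<bullet> (X *v u) \<le> R * (u \<bullet> (X *v u))"
proof -
  obtain v m where E: "eigensystem X v m" using symmetric_eigensystem[OF psd_symmetric[OF X]] .
  have m: "0 \<le> m i" "m i \<le> R" for i
    using psd_nonneg[OF X, of "v i"] R[of "v i"] eigensystemD(1)[OF E, of i i]
    by (simp_all add: eigensystem_value[OF E])
  have "(X *v u) \<bullet> (X *v u) = (\<Sum>i\<in>UNIV. m i * m i * (v i \<bullet> u)\<^sup>2)"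
    by (subst parseval[OF E]) (simp add: eigensystem_dot[OF E] power2_eq_square mult_ac)
  also have "\<dots> \<le> (\<Sum>i\<in>UNIV. R * m i * (v i \<bullet> u)\<^sup>2)"
    by (intro sum_mono mult_right_mono m) auto
  also have "\<dots> = R * (u \<bullet> (X *v u))"
    by (simp add: eigensystem_quadratic[OF E] sum_distrib_left mult.assoc)
  finally show ?thesis .
qed

subsection \<open>The trace exponential\<close>

text \<open>This and \<open>eigval\<close> project the same chosen pair, so that vectors and values
  match index by index.\<close>

definition eigvec :: "real^'n^'n \<Rightarrow> 'n \<Rightarrow> real^'n" where
  "eigvec A = fst (SOME e. eigensystem A (fst e) (snd e))"

definition eigval :: "real^'n^'n \<Rightarrow> 'n \<Rightarrow> real" where
  "eigval A = snd (SOME e. eigensystem A (fst e) (snd e))"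

lemma eigensystem_eigvec:
  assumes "transpose A = A"
  shows "eigensystem A (eigvec A) (eigval A)"
proof -
  have "\<exists>e. eigensystem A (fst e) (snd e)" by (rule symmetric_eigensystem[OF assms]) auto
  from someI_ex[OF this] show ?thesis unfolding eigvec_def eigval_def .
qed

text \<open>The traces of \<open>exp (- A)\<close> and of \<open>X exp (- A)\<close>. They are meaningful for symmetric
  \<open>A\<close> only; otherwise \<open>eigvec A\<close> and \<open>eigval A\<close> are arbitrary.\<close>

definition trexp :: "real^'n^'n \<Rightarrow> real" where
  "trexp A = (\<Sum>i\<in>UNIV. exp (- eigval A i))"

definition trexp_mult :: "real^'n^'n \<Rightarrow> real^'n^'n \<Rightarrow> real" where
  "trexp_mult X A = (\<Sum>i\<in>UNIV. exp (- eigval A i) * (eigvec A i \<bullet> (X *v eigvec A i)))"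

lemma trexp_mult_scaleR: "trexp_mult (c *\<^sub>R X) A = c * trexp_mult X A"
  by (simp add: trexp_mult_def sum_distrib_left scaleR_matrix_vector_assoc[symmetric] mult_ac)

lemma trexp_mult_uminus: "trexp_mult (- X) A = - trexp_mult X A"
  using trexp_mult_scaleR[of "-1" X A] by simp

lemma trexp_mult_sum: "trexp_mult (\<Sum>j\<in>J. X j) A = (\<Sum>j\<in>J. trexp_mult (X j) A)"
  unfolding trexp_mult_def sum_matrix_vector_mult inner_sum_right sum_distrib_left
  by (rule sum.swap)

lemma trexp_mult_ge:
  assumes A: "transpose A = A" and X: "\<And>v. c * (v \<bullet> v) \<le> v \<bullet> (X *v v)"
  shows "c * trexp A \<le> trexp_mult X A"
  unfolding trexp_def trexp_mult_def sum_distrib_left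
proof (rule sum_mono)
  fix i
  have "c * 1 \<le> eigvec A i \<bullet> (X *v eigvec A i)"
    using X[of "eigvec A i"] eigensystemD(1)[OF eigensystem_eigvec[OF A], of i i] by simp
  then show "c * exp (- eigval A i) \<le> exp (- eigval A i) * (eigvec A i \<bullet> (X *v eigvec A i))"
    by (simp add: mult.commute)
qed

text \<open>All quantities attached to \<open>A\<close> and \<open>B = A + X\<close> become sums against the same weights
  \<open>\<langle>u\<^sub>i, v\<^sub>j\<rangle>\<^sup>2\<close>, because \<open>\<langle>u\<^sub>i, X v\<^sub>j\<rangle> = (b\<^sub>j - a\<^sub>i) \<langle>u\<^sub>i, v\<^sub>j\<rangle>\<close>; trace
  inequalities thereby reduce to scalar ones.\<close>

context
  fixes A X B :: "real^'n^'n" and w :: "'n \<Rightarrow> 'n \<Rightarrow> real"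
  assumes A: "transpose A = A" and X: "transpose X = X"
  defines "B \<equiv> A + X"
  defines "w \<equiv> \<lambda>i j. (eigvec A i \<bullet> eigvec B j)\<^sup>2"
begin

lemma B_symmetric: "transpose B = B"
  by (simp add: B_def A X transpose_add)

lemma eigenvector_difference:
  "eigvec A i \<bullet> (X *v eigvec B j) = (eigval B j - eigval A i) * (eigvec A i \<bullet> eigvec B j)"
proof -
  have "eigvec A i \<bullet> (B *v eigvec B j) = eigval B j * (eigvec A i \<bullet> eigvec B j)"
    by (simp add: eigensystemD(2)[OF eigensystem_eigvec[OF B_symmetric]])
  moreover have "eigvec A i \<bullet> (A *v eigvec B j) = eigval A i * (eigvec A i \<bullet> eigvec B j)"
    by (rule eigensystem_dot[OF eigensystem_eigvec[OF A]])
  ultimately show ?thesis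
    by (simp add: B_def matrix_vector_mult_add_rdistrib inner_add_right algebra_simps)
qed

lemma eigenvector_difference':
  "eigvec B j \<bullet> (X *v eigvec A i) = (eigval B j - eigval A i) * (eigvec A i \<bullet> eigvec B j)"
  unfolding eigenvector_difference[symmetric] symmetric_dot[OF X, of "eigvec B j"]
  by (rule inner_commute)

text \<open>Each row and each column lists the squared coordinates of a unit vector in an
  orthonormal basis, so \<open>w\<close> is doubly stochastic.\<close>

lemma weights_sum:
  "(\<Sum>j\<in>UNIV. w i j) = 1" "(\<Sum>i\<in>UNIV. w i j) = 1"
  using parseval[OF eigensystem_eigvec[OF B_symmetric], of "eigvec A i" "eigvec A i"]
    parseval[OF eigensystem_eigvec[OF A], of "eigvec B j" "eigvec B j"]
    eigensystemD(1)[OF eigensystem_eigvec[OF A], of i i]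
    eigensystemD(1)[OF eigensystem_eigvec[OF B_symmetric], of j j]
  by (simp_all add: w_def power2_eq_square inner_commute)

lemma trexp_weights:
  "trexp A = (\<Sum>i\<in>UNIV. \<Sum>j\<in>UNIV. w i j * exp (- eigval A i))"
  "trexp B = (\<Sum>i\<in>UNIV. \<Sum>j\<in>UNIV. w i j * exp (- eigval B j))"
proof -
  show "trexp A = (\<Sum>i\<in>UNIV. \<Sum>j\<in>UNIV. w i j * exp (- eigval A i))"
    by (simp add: trexp_def sum_distrib_right[symmetric] weights_sum)
  show "trexp B = (\<Sum>i\<in>UNIV. \<Sum>j\<in>UNIV. w i j * exp (- eigval B j))"
    by (subst sum.swap) (simp add: trexp_def sum_distrib_right[symmetric] weights_sum)
qed

lemma trexp_mult_weights:
  "trexp_mult X A = (\<Sum>i\<in>UNIV. \<Sum>j\<in>UNIV. w i j * (exp (- eigval A i) * (eigval B j - eigval A i)))"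
  "trexp_mult X B = (\<Sum>i\<in>UNIV. \<Sum>j\<in>UNIV. w i j * (exp (- eigval B j) * (eigval B j - eigval A i)))"
proof -
  have "eigvec A i \<bullet> (X *v eigvec A i) = (\<Sum>j\<in>UNIV. w i j * (eigval B j - eigval A i))" for i
    by (subst parseval[OF eigensystem_eigvec[OF B_symmetric]])
      (simp add: eigenvector_difference' w_def power2_eq_square inner_commute mult_ac)
  then show "trexp_mult X A = (\<Sum>i\<in>UNIV. \<Sum>j\<in>UNIV. w i j * (exp (- eigval A i) * (eigval B j - eigval A i)))"
    by (simp add: trexp_mult_def sum_distrib_left mult_ac)
  have "eigvec B j \<bullet> (X *v eigvec B j) = (\<Sum>i\<in>UNIV. w i j * (eigval B j - eigval A i))" for j
    by (subst parseval[OF eigensystem_eigvec[OF A]])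
      (simp add: eigenvector_difference w_def power2_eq_square inner_commute mult_ac)
  then show "trexp_mult X B = (\<Sum>i\<in>UNIV. \<Sum>j\<in>UNIV. w i j * (exp (- eigval B j) * (eigval B j - eigval A i)))"
    by (subst sum.swap) (simp add: trexp_mult_def sum_distrib_left mult_ac)
qed

text \<open>In scalar form: the convex function exp (- x) lies above its tangent. The tangent is
  taken at the eigenvalues of \<open>A + X\<close>, which is why the first-order term is evaluated
  there.\<close>

lemma klein_inequality: "trexp (A + X) \<le> trexp A - trexp_mult X (A + X)"
proof -
  have *: "exp (- b) + exp (- b) * (b - a) \<le> exp (- a)" for a b :: real
  proof -
    have "exp (- b) * (1 + (b - a)) \<le> exp (- b) * exp (b - a)"
      by (intro mult_left_mono exp_ge_add_one_self) auto
    also have "\<dots> = exp (- a)" by (simp add: exp_add[symmetric])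
    finally show ?thesis by (simp add: algebra_simps)
  qed
  have "trexp B + trexp_mult X B \<le> trexp A"
    unfolding trexp_weights trexp_mult_weights sum.distrib[symmetric] distrib_left[symmetric]
    by (intro sum_mono mult_left_mono *) (simp add: w_def)
  then show ?thesis by (simp add: B_def)
qed

text \<open>The loss of the first-order term between \<open>A\<close> and \<open>A + X\<close> is
  bounded by the trapezoidal mean of second-order sums at both ends. Since X^2 is dominated by R X,
  each of these is at most \<open>R\<close> times the first-order term at its end; rearranging gives
  the two factors.\<close>

lemma trexp_mult_decay:
  assumes psd: "psd X" and R: "\<And>v. v \<bullet> (X *v v) \<le> R * (v \<bullet> v)"
  shows "(1 - R / 2) * trexp_mult X A \<le> (1 + R / 2) * trexp_mult X (A + X)"
proof -
  have scalar: "(exp (- a) - exp (- b)) * (b - a) \<le> (exp (- a) + exp (- b)) * (b - a)\<^sup>2 / 2"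
    for a b :: real
  proof -
    define t where "t = b - a"
    \<comment> \<open>This is tanh (t/2) <= t/2 for positive t, multiplied by t so that it holds for
      both signs.\<close>
    have tanh: "(1 - exp (- t)) * t \<le> (1 + exp (- t)) * t\<^sup>2 / 2" for t :: real
    proof -
      have pos: "1 - exp (- t) \<le> (1 + exp (- t)) * t / 2" if "t \<ge> 0" for t :: real
      proof -
        define h where "h = (\<lambda>t::real. (1 + exp (- t)) * t / 2 - (1 - exp (- t)))"
        have "h 0 \<le> h t"
        proof (rule DERIV_nonneg_imp_nondecreasing[OF that])
          fix x :: real assume "0 \<le> x"
          have "(h has_real_derivative (1 - exp (- x) * (1 + x)) / 2) (at x)"
            unfolding h_def by (auto intro!: derivative_eq_intros simp: field_simps)
          moreover have "exp (- x) * (1 + x) \<le> exp (- x) * exp x"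
            by (intro mult_left_mono exp_ge_add_one_self) auto
          then have "exp (- x) * (1 + x) \<le> 1" by (simp add: exp_minus)
          ultimately show "\<exists>y. (h has_real_derivative y) (at x) \<and> 0 \<le> y"
            by (intro exI conjI) auto
        qed
        then show ?thesis by (simp add: h_def)
      qed
      show ?thesis
      proof (cases "t \<ge> 0")
        case True
        from mult_right_mono[OF pos[OF True] True] show ?thesis
          by (simp add: power2_eq_square)
      next
        case False
        then have "1 - exp t \<le> (1 + exp t) * (- t) / 2" using pos[of "- t"] by simp
        \<comment> \<open>The bound for -t, multiplied by the positive number exp (- t) (- t),
          becomes the bound for t.\<close>
        then have "(1 - exp t) * (exp (- t) * (- t)) \<le> (1 + exp t) * (- t) / 2 * (exp (- t) * (- t))"
          using False by (intro mult_right_mono) (auto simp: mult_le_0_iff)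
        also have "\<dots> = (exp (- t) + exp (- t) * exp t) * t\<^sup>2 / 2"
          by (simp add: algebra_simps power2_eq_square)
        also have "(1 - exp t) * (exp (- t) * (- t)) = (exp (- t) * exp t - exp (- t)) * t"
          by (simp add: algebra_simps)
        finally show ?thesis by (simp add: exp_add[symmetric] add.commute)
      qed
    qed
    have "exp (- a) * ((1 - exp (- t)) * t) \<le> exp (- a) * ((1 + exp (- t)) * t\<^sup>2 / 2)"
      by (intro mult_left_mono tanh) auto
    moreover have "exp (- b) = exp (- a) * exp (- t)" by (simp add: t_def exp_add[symmetric])
    ultimately show ?thesis by (simp add: t_def[symmetric] algebra_simps)
  qed
  \<comment> \<open>For fixed \<open>i\<close> the inner sum is the squared norm of
    \<open>X *v eigvec A i\<close>, by Parseval in the eigenbasis of \<open>B\<close>.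
    \<open>B2\<close> exchanges the roles of the two bases.\<close>
  have A2: "(\<Sum>i\<in>UNIV. \<Sum>j\<in>UNIV. w i j * (exp (- eigval A i) * (eigval B j - eigval A i)\<^sup>2))
      \<le> R * trexp_mult X A"
  proof -
    have "(\<Sum>j\<in>UNIV. w i j * (eigval B j - eigval A i)\<^sup>2) \<le> R * (eigvec A i \<bullet> (X *v eigvec A i))" for i
    proof -
      have "(\<Sum>j\<in>UNIV. w i j * (eigval B j - eigval A i)\<^sup>2) = (X *v eigvec A i) \<bullet> (X *v eigvec A i)"
        by (subst parseval[OF eigensystem_eigvec[OF B_symmetric]])
          (simp add: eigenvector_difference' w_def power2_eq_square mult_ac)
      then show ?thesis using square_norm_le_of_psd[OF psd R] by simp
    qed
    then have "exp (- eigval A i) * (\<Sum>j\<in>UNIV. w i j * (eigval B j - eigval A i)\<^sup>2)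
        \<le> exp (- eigval A i) * (R * (eigvec A i \<bullet> (X *v eigvec A i)))" for i
      by (intro mult_left_mono) auto
    then have "(\<Sum>i\<in>UNIV. exp (- eigval A i) * (\<Sum>j\<in>UNIV. w i j * (eigval B j - eigval A i)\<^sup>2))
        \<le> (\<Sum>i\<in>UNIV. exp (- eigval A i) * (R * (eigvec A i \<bullet> (X *v eigvec A i))))"
      by (rule sum_mono)
    then show ?thesis by (simp add: trexp_mult_def sum_distrib_left mult_ac)
  qed
  have B2: "(\<Sum>i\<in>UNIV. \<Sum>j\<in>UNIV. w i j * (exp (- eigval B j) * (eigval B j - eigval A i)\<^sup>2))
      \<le> R * trexp_mult X B"
  proof -
    have "(\<Sum>i\<in>UNIV. w i j * (eigval B j - eigval A i)\<^sup>2) \<le> R * (eigvec B j \<bullet> (X *v eigvec B j))" for j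
    proof -
      have "(\<Sum>i\<in>UNIV. w i j * (eigval B j - eigval A i)\<^sup>2) = (X *v eigvec B j) \<bullet> (X *v eigvec B j)"
        by (subst parseval[OF eigensystem_eigvec[OF A]])
          (simp add: eigenvector_difference w_def power2_eq_square mult_ac)
      then show ?thesis using square_norm_le_of_psd[OF psd R] by simp
    qed
    then have "exp (- eigval B j) * (\<Sum>i\<in>UNIV. w i j * (eigval B j - eigval A i)\<^sup>2)
        \<le> exp (- eigval B j) * (R * (eigvec B j \<bullet> (X *v eigvec B j)))" for j
      by (intro mult_left_mono) auto
    then have "(\<Sum>j\<in>UNIV. exp (- eigval B j) * (\<Sum>i\<in>UNIV. w i j * (eigval B j - eigval A i)\<^sup>2))
        \<le> (\<Sum>j\<in>UNIV. exp (- eigval B j) * (R * (eigvec B j \<bullet> (X *v eigvec B j))))"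
      by (rule sum_mono)
    then show ?thesis
      by (subst sum.swap) (simp add: trexp_mult_def sum_distrib_left mult_ac)
  qed
  have "trexp_mult X A - trexp_mult X B \<le>
    ((\<Sum>i\<in>UNIV. \<Sum>j\<in>UNIV. w i j * (exp (- eigval A i) * (eigval B j - eigval A i)\<^sup>2)) +
     (\<Sum>i\<in>UNIV. \<Sum>j\<in>UNIV. w i j * (exp (- eigval B j) * (eigval B j - eigval A i)\<^sup>2))) / 2"
    unfolding trexp_mult_weights sum.distrib[symmetric] sum_subtractf[symmetric]
      sum_divide_distrib distrib_left[symmetric] right_diff_distrib[symmetric]
      left_diff_distrib[symmetric] distrib_right[symmetric] times_divide_eq_right[symmetric]
    using scalar by (intro sum_mono mult_left_mono) (simp_all add: w_def)
  with A2 B2 show ?thesis by (simp add: B_def field_simps)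
qed

end

text \<open>The midpoint is reached from \<open>A\<close> by adding \<open>X\<close> and from
  \<open>B\<close> by subtracting it. The first-order terms of the two Klein inequalities are taken
  at this common point and cancel.\<close>

lemma trexp_midpoint_convex:
  assumes A: "transpose A = A" and B: "transpose B = B"
  shows "2 * trexp ((1 / 2) *\<^sub>R (A + B)) \<le> trexp A + trexp B"
proof -
  define X where "X = (1 / 2) *\<^sub>R (B - A)"
  have X: "transpose X = X" "transpose (- X) = - X"
    using A B by (simp_all add: X_def transpose_def vec_eq_iff)
  have mid: "A + X = (1 / 2) *\<^sub>R (A + B)" "B + - X = (1 / 2) *\<^sub>R (A + B)"
    by (simp_all add: X_def vec_eq_iff field_simps)
  from klein_inequality[OF A X(1)] klein_inequality[OF B X(2)] show ?thesis
    by (simp only: mid trexp_mult_uminus)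
qed

text \<open>The base of the powers behaves like exp (- R/N), so the left-hand side is in essence a
  Riemann sum for the mean of exp (- x) over [0, R].\<close>

lemma chord_limit:
  fixes R :: real
  assumes "R > 0"
  shows "(\<lambda>N. (1 / real N) * (\<Sum>k<N. ((1 - R / (2 * real N)) / (1 + R / (2 * real N))) ^ Suc k))
    \<longlonglongrightarrow> (1 - exp (- R)) / R"
proof -
  define r where "r = (\<lambda>N::nat. (1 - R / (2 * real N)) / (1 + R / (2 * real N)))"
  \<comment> \<open>The closed form of the geometric sum, with \<open>powr\<close> because the
    exponent varies. It agrees with the natural power once \<open>r N\<close> is positive, which
    holds for N > R.\<close>
  have "(\<lambda>N. r N * (1 - r N powr real N) / (real N * (1 - r N))) \<longlonglongrightarrow> (1 - exp (- R)) * inverse R"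
    using assms unfolding r_def by real_asymp
  moreover have "\<forall>\<^sub>F N in sequentially. r N * (1 - r N powr real N) / (real N * (1 - r N))
      = (1 / real N) * (\<Sum>k<N. r N ^ Suc k)"
    using eventually_gt_at_top[of "nat \<lceil>R\<rceil>"]
  proof eventually_elim
    case (elim N)
    then have N: "real N > R" using assms by linarith
    define t where "t = R / (2 * real N)"
    have "0 < t" "t < 1" using N assms by (simp_all add: t_def pos_divide_less_eq)
    then have r: "r N > 0" "r N < 1"
      unfolding r_def t_def[symmetric] by (simp_all add: pos_divide_less_eq)
    have "(\<Sum>k<N. r N ^ Suc k) = r N * (1 - r N ^ N) / (1 - r N)"
      using r sum_gp_strict[of "r N" N] by (simp add: sum_distrib_left[symmetric])
    then show ?case using r N by (simp add: powr_realpow)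
  qed
  ultimately show ?thesis
    unfolding r_def divide_inverse[of _ R] by (rule Lim_transform_eventually)
qed

text \<open>The substitute for the Golden--Thompson inequality. Adding \<open>X\<close> in \<open>N\<close> equal steps, each
  step lowers the trace by at least the current trace of \<open>X exp (- A) / N\<close>, which itself shrinks
  by at most the factor \<open>(1 - R/2N) / (1 + R/2N)\<close>.\<close>

lemma trexp_add_le:
  assumes A: "transpose A = A" and X: "psd X" and R: "\<And>v. v \<bullet> (X *v v) \<le> R * (v \<bullet> v)" "R > 0"
  shows "trexp (A + X) \<le> trexp A - (1 - exp (- R)) / R * trexp_mult X A"
proof -
  have *: "trexp (A + X) \<le> trexp A -
      ((1 / real N) * (\<Sum>k<N. ((1 - R / (2 * real N)) / (1 + R / (2 * real N))) ^ Suc k)) * trexp_mult X A"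
    if N: "real N > R" for N
  proof -
    define c where "c = 1 / real N"
    define Y where "Y k = A + (c * real k) *\<^sub>R X" for k
    define r where "r = (1 - R / (2 * real N)) / (1 + R / (2 * real N))"
    have c: "c > 0" using N R by (simp add: c_def)
    have "R / (2 * real N) < 1" "0 \<le> R / (2 * real N)" using N R by (simp_all add: divide_simps)
    then have r: "r > 0" by (simp add: r_def)
    have Xs: "transpose X = X" by (rule psd_symmetric[OF X])
    have cX: "psd (c *\<^sub>R X)" "transpose (c *\<^sub>R X) = c *\<^sub>R X"
      using X c by (auto simp: psd_def transpose_scalar scaleR_matrix_vector_assoc[symmetric]
          transpose_def vec_eq_iff)
    have cR: "v \<bullet> ((c *\<^sub>R X) *v v) \<le> c * R * (v \<bullet> v)" for v
      using R(1)[of v] c by (simp add: scaleR_matrix_vector_assoc[symmetric])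
    have Y: "transpose (Y k) = Y k" for k
      using A Xs by (simp add: Y_def transpose_def vec_eq_iff)
    have Suc: "Y (Suc k) = Y k + c *\<^sub>R X" for k
      by (simp add: Y_def algebra_simps)
    \<comment> \<open>The first-order term sits at the end of each step, hence the powers
      \<open>r ^ Suc k\<close>, starting at exponent one.\<close>
    have step: "trexp (Y (Suc k)) \<le> trexp (Y k) - c * trexp_mult X (Y (Suc k))" for k
      using klein_inequality[OF Y cX(2)] by (simp add: Suc trexp_mult_scaleR)
    have dec: "r * trexp_mult X (Y k) \<le> trexp_mult X (Y (Suc k))" for k
    proof -
      have "c * ((1 - R / (2 * real N)) * trexp_mult X (Y k))
          \<le> c * ((1 + R / (2 * real N)) * trexp_mult X (Y (Suc k)))"
        using trexp_mult_decay[OF Y cX(2) cX(1) cR, of k]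
        by (simp add: Suc trexp_mult_scaleR c_def mult.left_commute mult.commute)
      then have "(1 - R / (2 * real N)) * trexp_mult X (Y k)
          \<le> (1 + R / (2 * real N)) * trexp_mult X (Y (Suc k))"
        using c by (rule mult_left_le_imp_le)
      moreover have "1 + R / (2 * real N) > 0" using N R by (simp add: add_pos_nonneg)
      ultimately show ?thesis by (simp add: r_def pos_divide_le_eq mult.commute)
    qed
    have pow: "r ^ k * trexp_mult X A \<le> trexp_mult X (Y k)" for k
    proof (induction k)
      case (Suc k)
      have "r ^ Suc k * trexp_mult X A \<le> r * trexp_mult X (Y k)"
        using Suc r by simp
      also note dec
      finally show ?case .
    qed (simp add: Y_def)
    have "trexp (Y m) \<le> trexp A - c * (\<Sum>k<m. r ^ Suc k) * trexp_mult X A" for m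
    proof (induction m)
      case (Suc m)
      have "c * (r ^ Suc m * trexp_mult X A) \<le> c * trexp_mult X (Y (Suc m))"
        using c by (intro mult_left_mono pow) auto
      with step[of m] Suc show ?case by (simp add: algebra_simps)
    qed (simp add: Y_def)
    from this[of N] N R show ?thesis by (simp add: Y_def c_def r_def)
  qed
  have ev: "\<forall>\<^sub>F N in sequentially. trexp (A + X) \<le> trexp A -
      ((1 / real N) * (\<Sum>k<N. ((1 - R / (2 * real N)) / (1 + R / (2 * real N))) ^ Suc k)) * trexp_mult X A"
    using eventually_gt_at_top[of "nat \<lceil>R\<rceil>"]
  proof eventually_elim
    case (elim N)
    then show ?case using R by (intro *) linarith
  qed
  have "(\<lambda>N. trexp A -
      ((1 / real N) * (\<Sum>k<N. ((1 - R / (2 * real N)) / (1 + R / (2 * real N))) ^ Suc k)) * trexp_mult X A)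
      \<longlonglongrightarrow> trexp A - (1 - exp (- R)) / R * trexp_mult X A"
    by (intro tendsto_intros chord_limit R)
  from tendsto_lowerbound[OF this ev] show ?thesis by simp
qed

subsection \<open>Sampling without replacement\<close>

lemma finite_samples: "finite (samples n s)"
  by (rule finite_subset[of _ "Pow {1..n}"]) (auto simp: samples_def)

lemma card_samples: "card (samples n s) = n choose s"
  using n_subsets[of "{1..n}" s] by (simp add: samples_def)

text \<open>Double counting: a set \<open>T\<close> with a new element \<open>k\<close> corresponds
  to a larger set \<open>S\<close> with a marked element \<open>k\<close>.\<close>

lemma samples_sum_swap:
  fixes H :: "nat set \<Rightarrow> nat \<Rightarrow> real"
  shows "(\<Sum>T\<in>samples n s. \<Sum>k\<in>{1..n} - T. H T k) = (\<Sum>S\<in>samples n (Suc s). \<Sum>k\<in>S. H (S - {k}) k)"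
proof -
  have finS: "finite S" if "S \<in> samples n m" for S m
    using that by (auto simp: samples_def intro: finite_subset)
  show ?thesis
    using finS by (subst (1 2) sum.Sigma) (auto intro!: finite_samples
        sum.reindex_bij_witness[where i = "\<lambda>(S, k). (S - {k}, k)" and j = "\<lambda>(T, k). (insert k T, k)"]
        simp: samples_def)
qed

text \<open>Hoeffding's comparison with replacement, one draw at a time. If the last draw repeats an
  earlier one, the repeated pair \<open>2 X\<^sub>j\<close> is compared with \<open>X\<^sub>j + X\<^sub>k\<close> by convexity.\<close>

lemma without_replacement_le:
  fixes \<Phi> :: "'v::real_vector \<Rightarrow> real" and X :: "nat \<Rightarrow> 'v"
  assumes C: "subspace C" and X: "\<And>j. j \<in> {1..n} \<Longrightarrow> X j \<in> C"
    and conv: "\<And>a b. a \<in> C \<Longrightarrow> b \<in> C \<Longrightarrow> 2 * \<Phi> ((1 / 2) *\<^sub>R (a + b)) \<le> \<Phi> a + \<Phi> b"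
    and s: "Suc s \<le> n"
  shows "real n * real (Suc s) * (\<Sum>S\<in>samples n (Suc s). \<Phi> (\<Sum>j\<in>S. X j))
    \<le> real (n - s) * (\<Sum>T\<in>samples n s. \<Sum>j=1..n. \<Phi> ((\<Sum>i\<in>T. X i) + X j))"
proof -
  define P where "P S = \<Phi> (\<Sum>j\<in>S. X j)" for S
  define G where "G T j = \<Phi> ((\<Sum>i\<in>T. X i) + X j)" for T j
  have fin: "finite S" if "S \<in> samples n m" for S m
    using that by (auto simp: samples_def intro: finite_subset)
  \<comment> \<open>Draws outside \<open>T\<close>: every set of size \<open>Suc s\<close> arises
    once for each of its elements.\<close>
  have new: "(\<Sum>T\<in>samples n s. \<Sum>j\<in>{1..n} - T. G T j) = real (Suc s) * (\<Sum>S\<in>samples n (Suc s). P S)"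
  proof -
    have "(\<Sum>k\<in>S. G (S - {k}) k) = real (Suc s) * P S" if S: "S \<in> samples n (Suc s)" for S
    proof -
      have "G (S - {k}) k = P S" if "k \<in> S" for k
        using sum.remove[OF fin[OF S] that, of X] by (simp add: G_def P_def add.commute)
      then show ?thesis using S by (simp add: samples_def)
    qed
    then show ?thesis unfolding samples_sum_swap sum_distrib_left by (rule sum.cong[OF refl])
  qed
  have old: "real s * real (Suc s) * (\<Sum>S\<in>samples n (Suc s). P S)
      \<le> real (n - s) * (\<Sum>T\<in>samples n s. \<Sum>j\<in>T. G T j)"
  proof -
    have "real s * real (Suc s) * P S \<le> (\<Sum>k\<in>S. \<Sum>j\<in>S - {k}. G (S - {k}) j)"
      if S: "S \<in> samples n (Suc s)" for S
    proof -
      \<comment> \<open>The two sums on the right come from that over \<open>S\<close> by replacing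
        \<open>k\<close> with a second copy of \<open>j\<close> and conversely. Their midpoint is
        the sum over \<open>S\<close>.\<close>
      have pair: "2 * P S \<le> G (S - {k}) j + G (S - {j}) k" if jk: "k \<in> S" "j \<in> S" for j k
      proof -
        define z where "z = (\<Sum>i\<in>S. X i)"
        have k: "(\<Sum>i\<in>S - {k}. X i) = z - X k" and j: "(\<Sum>i\<in>S - {j}. X i) = z - X j"
          unfolding z_def using jk fin[OF S] by (simp_all add: sum_diff1)
        have "X k \<in> C" "X j \<in> C" "z \<in> C"
          using jk S X by (auto simp: samples_def z_def intro!: subspace_sum[OF C])
        then have "2 * \<Phi> ((1 / 2) *\<^sub>R ((z - X k + X j) + (z - X j + X k)))
            \<le> \<Phi> (z - X k + X j) + \<Phi> (z - X j + X k)"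
          by (intro conv subspace_add[OF C] subspace_diff[OF C])
        also have "(1 / 2) *\<^sub>R ((z - X k + X j) + (z - X j + X k)) = z"
          by (simp add: algebra_simps flip: scaleR_2)
        finally show ?thesis by (simp add: P_def G_def k j z_def)
      qed
      have swap: "(\<Sum>k\<in>S. \<Sum>j\<in>S - {k}. G (S - {j}) k) = (\<Sum>k\<in>S. \<Sum>j\<in>S - {k}. G (S - {k}) j)"
        using fin[OF S] by (subst (1 2) sum.Sigma)
          (auto intro!: sum.reindex_bij_witness[where i = prod.swap and j = prod.swap])
      have "real s * real (Suc s) * (2 * P S) = (\<Sum>k\<in>S. \<Sum>j\<in>S - {k}. 2 * P S)"
        using S fin[OF S] by (simp add: samples_def)
      also have "\<dots> \<le> (\<Sum>k\<in>S. \<Sum>j\<in>S - {k}. G (S - {k}) j + G (S - {j}) k)"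
        by (intro sum_mono pair) auto
      also have "\<dots> = 2 * (\<Sum>k\<in>S. \<Sum>j\<in>S - {k}. G (S - {k}) j)"
        by (simp add: sum.distrib swap)
      finally show ?thesis by simp
    qed
    then have "(\<Sum>S\<in>samples n (Suc s). real s * real (Suc s) * P S)
        \<le> (\<Sum>S\<in>samples n (Suc s). \<Sum>k\<in>S. \<Sum>j\<in>S - {k}. G (S - {k}) j)"
      by (rule sum_mono)
    also have "\<dots> = (\<Sum>T\<in>samples n s. \<Sum>k\<in>{1..n} - T. \<Sum>j\<in>T. G T j)"
      by (rule samples_sum_swap[symmetric])
    also have "\<dots> = (\<Sum>T\<in>samples n s. real (n - s) * (\<Sum>j\<in>T. G T j))"
      by (intro sum.cong refl) (simp add: samples_def card_Diff_subset finite_subset[of _ "{1..n}"])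
    finally show ?thesis by (simp add: sum_distrib_left)
  qed
  have "(\<Sum>T\<in>samples n s. \<Sum>j=1..n. G T j)
      = (\<Sum>T\<in>samples n s. (\<Sum>j\<in>{1..n} - T. G T j) + (\<Sum>j\<in>T. G T j))"
    by (intro sum.cong refl sum.subset_diff) (auto simp: samples_def)
  also have "\<dots> = real (Suc s) * (\<Sum>S\<in>samples n (Suc s). P S) + (\<Sum>T\<in>samples n s. \<Sum>j\<in>T. G T j)"
    by (simp only: sum.distrib new)
  finally have "real (n - s) * (\<Sum>T\<in>samples n s. \<Sum>j=1..n. G T j)
      = real (n - s) * real (Suc s) * (\<Sum>S\<in>samples n (Suc s). P S)
        + real (n - s) * (\<Sum>T\<in>samples n s. \<Sum>j\<in>T. G T j)"
    by (simp add: algebra_simps)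
  \<comment> \<open>The factor n splits as (n - s) + s: the first part is matched exactly by new
    draws, the second is bounded by repeated ones.\<close>
  moreover have "real n * real (Suc s) * (\<Sum>S\<in>samples n (Suc s). P S)
      = real (n - s) * real (Suc s) * (\<Sum>S\<in>samples n (Suc s). P S)
        + real s * real (Suc s) * (\<Sum>S\<in>samples n (Suc s). P S)"
    unfolding distrib_right[symmetric] using s by simp
  ultimately show ?thesis
    using old unfolding P_def[symmetric] G_def[symmetric] by linarith
qed

section \<open>The lower-tail matrix Chernoff bound\<close>

lemma exp_minus_quadratic_le_trexp:
  assumes A: "transpose A = A" and v: "v \<bullet> v = 1"
  shows "exp (- (v \<bullet> (A *v v))) \<le> trexp A"
proof -
  note E = eigensystem_eigvec[OF A]
  \<comment> \<open>For a unit vector the quadratic form is a weighted mean of the eigenvalues, so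
    they cannot all exceed it.\<close>
  have "\<exists>i. eigval A i \<le> v \<bullet> (A *v v)"
  proof (rule ccontr)
    assume neg: "\<nexists>i. eigval A i \<le> v \<bullet> (A *v v)"
    have one: "(\<Sum>i\<in>UNIV. (eigvec A i \<bullet> v)\<^sup>2) = 1"
      using eigensystem_norm[OF E, of v] v by (simp add: dot_square_norm)
    then obtain k where k: "eigvec A k \<bullet> v \<noteq> 0"
      by (metis (no_types, lifting) sum.neutral zero_neq_one zero_power2)
    have "(\<Sum>i\<in>UNIV. v \<bullet> (A *v v) * (eigvec A i \<bullet> v)\<^sup>2) < (\<Sum>i\<in>UNIV. eigval A i * (eigvec A i \<bullet> v)\<^sup>2)"
    proof (rule sum_strict_mono_ex1)
      show "\<forall>i\<in>UNIV. v \<bullet> (A *v v) * (eigvec A i \<bullet> v)\<^sup>2 \<le> eigval A i * (eigvec A i \<bullet> v)\<^sup>2"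
        using neg by (auto intro!: mult_right_mono simp: not_le less_imp_le)
      show "\<exists>i\<in>UNIV. v \<bullet> (A *v v) * (eigvec A i \<bullet> v)\<^sup>2 < eigval A i * (eigvec A i \<bullet> v)\<^sup>2"
        using k neg by (auto intro!: exI[of _ k] mult_strict_right_mono simp: not_le)
    qed simp
    then show False
      by (simp add: sum_distrib_left[symmetric] one eigensystem_quadratic[OF E, symmetric])
  qed
  then obtain i where "eigval A i \<le> v \<bullet> (A *v v)" ..
  then have "exp (- (v \<bullet> (A *v v))) \<le> exp (- eigval A i)" by simp
  also have "\<dots> \<le> trexp A"
    unfolding trexp_def by (rule member_le_sum) auto
  finally show ?thesis .
qed

text \<open>The value for the empty sample; the dimension factor of the Chernoff bound enters
  here.\<close>

lemma trexp_zero: "trexp (0 :: real^'n^'n) = real CARD('n)"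
proof -
  have "eigval (0 :: real^'n^'n) i = 0" for i
    using eigensystem_value[OF eigensystem_eigvec, of "0 :: real^'n^'n" i]
    by (simp add: transpose_def vec_eq_iff)
  then show ?thesis by (simp add: trexp_def)
qed

text \<open>Any unit vector can serve as test vector. The inequality keeps the contraction factors
  of the Chernoff argument nonnegative.\<close>

lemma mean_lower_le_upper:
  fixes X :: "nat \<Rightarrow> real^'p^'p"
  assumes R: "\<And>j v. j \<in> {1..n} \<Longrightarrow> v \<bullet> (X j *v v) \<le> R * (v \<bullet> v)"
    and c: "\<And>v. real n * c * (v \<bullet> v) \<le> v \<bullet> ((\<Sum>j=1..n. X j) *v v)"
    and n: "real n > 0"
  shows "c \<le> R"
proof -
  define v :: "real^'p" where "v = axis undefined 1"
  have v: "v \<bullet> v = 1" by (simp add: v_def inner_axis_axis)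
  have "real n * c * (v \<bullet> v) \<le> (\<Sum>j=1..n. v \<bullet> (X j *v v))"
    using c[of v] by (simp add: sum_matrix_vector_mult inner_sum_right)
  also have "\<dots> \<le> (\<Sum>j=1..n. R * (v \<bullet> v))" by (intro sum_mono R)
  finally show ?thesis using n by (simp add: v)
qed

text \<open>Each draw is first replaced by an independent one; averaging \<open>trexp_add_le\<close>
  over that draw then contributes one factor. Sums are left unnormalized, which produces the
  binomial coefficient.\<close>

lemma sum_trexp_samples_le:
  fixes X :: "nat \<Rightarrow> real^'p^'p"
  assumes X: "\<And>j. j \<in> {1..n} \<Longrightarrow> psd (X j)"
    and R: "\<And>j v. j \<in> {1..n} \<Longrightarrow> v \<bullet> (X j *v v) \<le> R * (v \<bullet> v)" "R > 0"
    and c: "\<And>v. real n * c * (v \<bullet> v) \<le> v \<bullet> ((\<Sum>j=1..n. X j) *v v)"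
    and "s \<le> n"
  shows "(\<Sum>S\<in>samples n s. trexp (\<Sum>j\<in>S. X j))
    \<le> real (n choose s) * real CARD('p) * (1 - (1 - exp (- R)) / R * c) ^ s"
  using \<open>s \<le> n\<close>
proof (induction s)
  case 0
  have "S = {}" if "S \<subseteq> {1..n}" "card S = 0" for S
    using that finite_subset[OF that(1)] by auto
  then have "samples n 0 = {{}}" by (auto simp: samples_def)
  then show ?case by (simp add: trexp_zero)
next
  case (Suc s)
  define \<kappa> where "\<kappa> = (1 - exp (- R)) / R"
  have \<kappa>: "\<kappa> \<ge> 0" using R by (simp add: \<kappa>_def)
  have n: "real n > 0" using Suc.prems by simp
  have cR: "c \<le> R" by (rule mean_lower_le_upper[OF R(1) c n])
  have q: "1 - \<kappa> * c \<ge> 0"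
  proof -
    have "\<kappa> * c \<le> \<kappa> * R" using \<kappa> cR by (rule mult_left_mono[rotated])
    also have "\<dots> \<le> 1" using R by (simp add: \<kappa>_def)
    finally show ?thesis by simp
  qed
  have sub: "subspace {A :: real^'p^'p. transpose A = A}"
    by (auto simp: subspace_def transpose_def vec_eq_iff)
  have step: "(\<Sum>j=1..n. trexp ((\<Sum>i\<in>T. X i) + X j)) \<le> real n * (1 - \<kappa> * c) * trexp (\<Sum>i\<in>T. X i)"
    if T: "T \<in> samples n s" for T
  proof -
    define A where "A = (\<Sum>i\<in>T. X i)"
    have A: "transpose A = A"
      unfolding A_def transpose_sum using T X
      by (intro sum.cong refl psd_symmetric X) (auto simp: samples_def)
    have "(\<Sum>j=1..n. trexp (A + X j)) \<le> (\<Sum>j=1..n. trexp A - \<kappa> * trexp_mult (X j) A)"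
      unfolding \<kappa>_def by (intro sum_mono trexp_add_le A X R)
    also have "\<dots> = real n * trexp A - \<kappa> * trexp_mult (\<Sum>j=1..n. X j) A"
      by (simp add: sum_subtractf trexp_mult_sum sum_distrib_left)
    also have "\<dots> \<le> real n * trexp A - \<kappa> * (real n * c * trexp A)"
      using trexp_mult_ge[OF A c] \<kappa> by (intro diff_left_mono mult_left_mono)
    also have "\<dots> = real n * (1 - \<kappa> * c) * trexp A" by (simp add: algebra_simps)
    finally show ?thesis unfolding A_def .
  qed
  \<comment> \<open>Both sides count pairs of a set of size s and an element outside it; this
    converts the number of samples from s to s + 1.\<close>
  have choose: "real (Suc s) * real (n choose Suc s) = real (n - s) * real (n choose s)"
    by (metis binomial_absorb_comp binomial_absorption of_nat_mult)
  have "real n * real (Suc s) * (\<Sum>S\<in>samples n (Suc s). trexp (\<Sum>j\<in>S. X j))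
      \<le> real (n - s) * (\<Sum>T\<in>samples n s. \<Sum>j=1..n. trexp ((\<Sum>i\<in>T. X i) + X j))"
    using Suc.prems
    by (intro without_replacement_le[OF sub]) (auto intro!: trexp_midpoint_convex psd_symmetric X)
  also have "\<dots> \<le> real (n - s) * (\<Sum>T\<in>samples n s. real n * (1 - \<kappa> * c) * trexp (\<Sum>i\<in>T. X i))"
    by (intro mult_left_mono sum_mono step) auto
  also have "\<dots> = real (n - s) * (real n * (1 - \<kappa> * c)) * (\<Sum>T\<in>samples n s. trexp (\<Sum>i\<in>T. X i))"
    by (simp only: sum_distrib_left[symmetric] mult.assoc)
  also have "\<dots> \<le> real (n - s) * (real n * (1 - \<kappa> * c)) *
      (real (n choose s) * real CARD('p) * (1 - \<kappa> * c) ^ s)"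
    using Suc q unfolding \<kappa>_def[symmetric] by (intro mult_left_mono) auto
  also have "\<dots> = real n * (real (n - s) * real (n choose s)) * real CARD('p) * (1 - \<kappa> * c) ^ Suc s"
    by (simp add: mult_ac)
  also have "\<dots> = real n * real (Suc s) * (real (n choose Suc s) * real CARD('p) * (1 - \<kappa> * c) ^ Suc s)"
    unfolding choose[symmetric] by (simp only: mult_ac)
  finally have "real n * real (Suc s) * (\<Sum>S\<in>samples n (Suc s). trexp (\<Sum>j\<in>S. X j))
    \<le> real n * real (Suc s) * (real (n choose Suc s) * real CARD('p) * (1 - \<kappa> * c) ^ Suc s)" .
  moreover have "real n * real (Suc s) > 0" using n by simp
  ultimately show ?case unfolding \<kappa>_def by (rule mult_left_le_imp_le)
qed

text \<open>The difference of the two sides vanishes at 0 and has derivative - ln (1 - x) - x >= 0.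
  It simplifies the exact Chernoff exponent.\<close>

lemma half_square_le_entropy:
  fixes e :: real
  assumes "0 \<le> e" "e < 1"
  shows "e\<^sup>2 / 2 \<le> e + (1 - e) * ln (1 - e)"
proof -
  define h where "h = (\<lambda>t::real. t + (1 - t) * ln (1 - t) - t\<^sup>2 / 2)"
  have "h 0 \<le> h e"
  proof (rule DERIV_nonneg_imp_nondecreasing[OF assms(1)])
    fix x assume x: "0 \<le> x" "x \<le> e"
    have x1: "1 - x > 0" using x assms by simp
    have "(h has_real_derivative (- ln (1 - x) - x)) (at x)"
      unfolding h_def using x1 by (auto intro!: derivative_eq_intros)
    moreover have "ln (1 - x) \<le> - x" using ln_le_minus_one[of "1 - x"] x assms by simp
    ultimately show "\<exists>y. (h has_real_derivative y) (at x) \<and> 0 \<le> y" by (intro exI conjI) auto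
  qed
  then show ?thesis by (simp add: h_def)
qed

theorem matrix_chernoff_without_replacement:
  fixes H :: "nat \<Rightarrow> real^'p^'p"
  assumes H: "\<And>j. j \<in> {1..n} \<Longrightarrow> psd (H j)"
    and R: "\<And>j v. j \<in> {1..n} \<Longrightarrow> v \<bullet> (H j *v v) \<le> R * (v \<bullet> v)" "R > 0"
    and g: "\<And>v. real n * \<gamma> * (v \<bullet> v) \<le> v \<bullet> ((\<Sum>j=1..n. H j) *v v)" "\<gamma> > 0"
    and e: "0 < \<epsilon>" "\<epsilon> < 1" and s: "s \<le> n" "n > 0"
  shows "measure_pmf.prob (pmf_of_set (samples n s))
      {S. \<exists>v. v \<bullet> ((\<Sum>j\<in>S. H j) *v v) < real s * (1 - \<epsilon>) * \<gamma> * (v \<bullet> v)}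
    \<le> real CARD('p) * exp (- (real s * \<gamma> * \<epsilon>\<^sup>2 / (2 * R)))"
proof -
  define bad where "bad = {S \<in> samples n s. \<exists>v. v \<bullet> ((\<Sum>j\<in>S. H j) *v v) < real s * (1 - \<epsilon>) * \<gamma> * (v \<bullet> v)}"
  have \<gamma>R: "\<gamma> \<le> R" using mean_lower_le_upper[OF R(1) g(1)] s(2) by simp
  \<comment> \<open>The parameter that minimizes the resulting exponent, determined by exp (-
    \<theta> R) = 1 - \<epsilon>.\<close>
  define \<theta> where "\<theta> = - ln (1 - \<epsilon>) / R"
  have \<theta>: "\<theta> > 0" using e R by (simp add: \<theta>_def ln_less_zero divide_neg_pos)
  have \<theta>R: "\<theta> * R = - ln (1 - \<epsilon>)" "exp (- (\<theta> * R)) = 1 - \<epsilon>" using e R by (simp_all add: \<theta>_def)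
  define t where "t = \<theta> * (real s * (1 - \<epsilon>) * \<gamma>)"
  have X: "psd (\<theta> *\<^sub>R H j)" "v \<bullet> ((\<theta> *\<^sub>R H j) *v v) \<le> \<theta> * R * (v \<bullet> v)" if "j \<in> {1..n}" for j v
    using H[OF that] R(1)[OF that, of v] \<theta>
    by (auto simp: psd_def transpose_def vec_eq_iff scaleR_matrix_vector_assoc[symmetric])
  have "exp (- t) \<le> trexp (\<Sum>j\<in>S. \<theta> *\<^sub>R H j)" if S: "S \<in> bad" for S
  proof -
    have SI: "S \<subseteq> {1..n}" using S by (auto simp: bad_def samples_def)
    obtain v where v: "v \<bullet> ((\<Sum>j\<in>S. H j) *v v) < real s * (1 - \<epsilon>) * \<gamma> * (v \<bullet> v)"
      using S by (auto simp: bad_def)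
    then have v0: "v \<noteq> 0" by auto
    define u where "u = v /\<^sub>R norm v"
    have u: "u \<bullet> u = 1" using v0 by (simp add: u_def dot_square_norm power2_eq_square)
    have "u \<bullet> ((\<Sum>j\<in>S. H j) *v u) = v \<bullet> ((\<Sum>j\<in>S. H j) *v v) / (v \<bullet> v)"
      using v0 by (simp add: u_def matrix_vector_mult_scaleR dot_square_norm power2_eq_square field_simps)
    also have "\<dots> \<le> real s * (1 - \<epsilon>) * \<gamma>"
      using v v0 by (simp add: pos_divide_le_eq less_imp_le)
    finally have "\<theta> * (u \<bullet> ((\<Sum>j\<in>S. H j) *v u)) \<le> t"
      unfolding t_def using \<theta> by (intro mult_left_mono) auto
    then have "exp (- t) \<le> exp (- (u \<bullet> ((\<Sum>j\<in>S. \<theta> *\<^sub>R H j) *v u)))"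
      by (simp add: scaleR_sum_right[symmetric] scaleR_matrix_vector_assoc[symmetric])
    also have "\<dots> \<le> trexp (\<Sum>j\<in>S. \<theta> *\<^sub>R H j)"
    proof (rule exp_minus_quadratic_le_trexp[OF _ u])
      show "transpose (\<Sum>j\<in>S. \<theta> *\<^sub>R H j) = (\<Sum>j\<in>S. \<theta> *\<^sub>R H j)"
        unfolding transpose_sum using SI by (intro sum.cong refl psd_symmetric X) auto
    qed
    finally show ?thesis .
  qed
  \<comment> \<open>Markov's inequality in counting form: every bad sample contributes at least
    \<open>exp (- t)\<close>.\<close>
  then have "real (card bad) * exp (- t) \<le> (\<Sum>S\<in>bad. trexp (\<Sum>j\<in>S. \<theta> *\<^sub>R H j))"
    using sum_bounded_below[of bad "exp (- t)"] by simp
  also have "\<dots> \<le> (\<Sum>S\<in>samples n s. trexp (\<Sum>j\<in>S. \<theta> *\<^sub>R H j))"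
    by (intro sum_mono2 finite_samples) (auto simp: bad_def trexp_def intro: sum_nonneg)
  also have "\<dots> \<le> real (n choose s) * real CARD('p)
      * (1 - (1 - exp (- (\<theta> * R))) / (\<theta> * R) * (\<theta> * \<gamma>)) ^ s"
  proof (rule sum_trexp_samples_le[OF X _ _ s(1)])
    show "real n * (\<theta> * \<gamma>) * (v \<bullet> v) \<le> v \<bullet> ((\<Sum>j=1..n. \<theta> *\<^sub>R H j) *v v)" for v
      using mult_left_mono[OF g(1)[of v], of \<theta>] \<theta>
      by (simp add: scaleR_sum_right[symmetric] scaleR_matrix_vector_assoc[symmetric] mult_ac)
  qed (use \<theta> R in auto)
  also have "(1 - exp (- (\<theta> * R))) / (\<theta> * R) * (\<theta> * \<gamma>) = \<epsilon> * \<gamma> / R"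
    using \<theta> R by (simp add: \<theta>R(2) del: exp_minus)
  also have "(1 - \<epsilon> * \<gamma> / R) ^ s \<le> exp (- (\<epsilon> * \<gamma> / R)) ^ s"
  proof (rule power_mono)
    show "1 - \<epsilon> * \<gamma> / R \<le> exp (- (\<epsilon> * \<gamma> / R))"
      using exp_ge_add_one_self[of "- (\<epsilon> * \<gamma> / R)"] by simp
    have "\<epsilon> * \<gamma> \<le> 1 * R" using e g \<gamma>R by (intro mult_mono) auto
    then show "0 \<le> 1 - \<epsilon> * \<gamma> / R" using R by (simp add: pos_divide_le_eq)
  qed
  finally have main: "real (card bad) * exp (- t)
      \<le> real (n choose s) * real CARD('p) * exp (- (\<epsilon> * \<gamma> / R)) ^ s"
    by (simp add: mult_left_mono)
  \<comment> \<open>The left-hand side equals - (s \<gamma> / R) (\<epsilon> + (1 - \<epsilon>) ln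
    (1 - \<epsilon>)).\<close>
  have "t + real s * (- (\<epsilon> * \<gamma> / R)) \<le> - (real s * \<gamma> * \<epsilon>\<^sup>2 / (2 * R))"
  proof -
    have "real s * \<gamma> / R * (\<epsilon>\<^sup>2 / 2) \<le> real s * \<gamma> / R * (\<epsilon> + (1 - \<epsilon>) * ln (1 - \<epsilon>))"
      using half_square_le_entropy[of \<epsilon>] e R g by (intro mult_left_mono) auto
    then show ?thesis by (simp add: t_def \<theta>_def algebra_simps add_divide_distrib)
  qed
  then have "exp t * exp (- (\<epsilon> * \<gamma> / R)) ^ s \<le> exp (- (real s * \<gamma> * \<epsilon>\<^sup>2 / (2 * R)))"
    by (simp only: exp_of_nat_mult[symmetric] exp_add[symmetric] exp_le_cancel_iff)
  then have "real (n choose s) * real CARD('p) * (exp t * exp (- (\<epsilon> * \<gamma> / R)) ^ s)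
      \<le> real (n choose s) * real CARD('p) * exp (- (real s * \<gamma> * \<epsilon>\<^sup>2 / (2 * R)))"
    by (intro mult_left_mono) auto
  moreover have "real (card bad) \<le> real (n choose s) * real CARD('p) * (exp t * exp (- (\<epsilon> * \<gamma> / R)) ^ s)"
  proof -
    have "real (card bad) = real (card bad) * exp (- t) * exp t"
      by (simp add: mult.assoc flip: exp_add)
    also have "\<dots> \<le> real (n choose s) * real CARD('p) * exp (- (\<epsilon> * \<gamma> / R)) ^ s * exp t"
      by (intro mult_right_mono main) auto
    finally show ?thesis by (simp only: mult_ac)
  qed
  ultimately have "real (card bad)
      \<le> real (n choose s) * real CARD('p) * exp (- (real s * \<gamma> * \<epsilon>\<^sup>2 / (2 * R)))"
    by (rule order_trans[rotated])
  moreover have "real (n choose s) > 0" using s by simp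
  moreover have "samples n s \<noteq> {}" using card_samples[of n s] s by (metis card.empty binomial_eq_0_iff not_le)
  then have "measure_pmf.prob (pmf_of_set (samples n s))
      {S. \<exists>v. v \<bullet> ((\<Sum>j\<in>S. H j) *v v) < real s * (1 - \<epsilon>) * \<gamma> * (v \<bullet> v)}
      = real (card bad) / real (n choose s)"
    by (subst measure_pmf_of_set) (auto simp: finite_samples card_samples bad_def Int_def)
  ultimately show ?thesis by (simp add: pos_divide_le_eq mult_ac)
qed

subsection \<open>Gradients and second-order expansions\<close>

lemma grad_eqI:
  assumes "GDERIV f x :> D"
  shows "grad f x = D"
  unfolding grad_def
proof (rule the_equality[where P = "\<lambda>D. GDERIV f x :> D", OF assms])
  fix D' assume "GDERIV f x :> D'"
  with assms have "(\<lambda>h. h \<bullet> D) = (\<lambda>h. h \<bullet> D')"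
    unfolding gderiv_def by (rule has_derivative_unique)
  then show "D' = D" by (metis vector_eq_ldot)
qed

text \<open>The Riesz representation in coordinates: the gradient has the values of the derivative
  on the basis as its components.\<close>

lemma GDERIV_grad:
  assumes "f differentiable (at x)"
  shows "GDERIV f x :> grad f x"
proof -
  obtain f' where f': "(f has_derivative f') (at x)" using assms by (auto simp: differentiable_def)
  then have lin: "linear f'" by (rule has_derivative_linear)
  have "f' h = h \<bullet> (\<Sum>b\<in>Basis. f' b *\<^sub>R b)" for h
  proof -
    have "f' h = f' (\<Sum>b\<in>Basis. (h \<bullet> b) *\<^sub>R b)" by (simp add: euclidean_representation)
    also have "\<dots> = (\<Sum>b\<in>Basis. (h \<bullet> b) * f' b)"
      by (simp add: linear_sum[OF lin] linear_scale[OF lin])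
    finally show ?thesis by (simp add: inner_sum_right mult.commute)
  qed
  then have "f' = (\<lambda>h. h \<bullet> (\<Sum>b\<in>Basis. f' b *\<^sub>R b))" by (rule ext)
  with f' have D: "GDERIV f x :> (\<Sum>b\<in>Basis. f' b *\<^sub>R b)" by (simp add: gderiv_def)
  then show ?thesis using grad_eqI[OF D] by simp
qed

lemma hessian_has_derivative:
  assumes "twice_differentiable f"
  shows "(grad f has_derivative (\<lambda>h. hessian f x *v h)) (at x)"
  using assms unfolding hessian_def twice_differentiable_def by (simp add: jacobian_works)

lemma hessian_eqI:
  assumes "(grad f has_derivative (\<lambda>h. H *v h)) (at x)"
  shows "hessian f x = H"
  unfolding hessian_def jacobian_def frechet_derivative_at[OF assms, symmetric] by simp

lemma average_twice_differentiable:
  fixes f :: "nat \<Rightarrow> real^'p \<Rightarrow> real"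
  assumes F: "\<And>y. F y = c * (\<Sum>i\<in>I. f i y)"
    and f: "\<And>i. i \<in> I \<Longrightarrow> twice_differentiable (f i)"
  shows "twice_differentiable F" "hessian F y = c *\<^sub>R (\<Sum>i\<in>I. hessian (f i) y)"
proof -
  have deriv: "(f i has_derivative (\<lambda>h. h \<bullet> grad (f i) y)) (at y)" if "i \<in> I" for i y
    using f[OF that] GDERIV_grad[of "f i" y] by (simp add: gderiv_def twice_differentiable_def)
  have G: "GDERIV F y :> c *\<^sub>R (\<Sum>i\<in>I. grad (f i) y)" for y
  proof -
    have "((\<lambda>y. c * (\<Sum>i\<in>I. f i y)) has_derivative (\<lambda>h. c * (\<Sum>i\<in>I. h \<bullet> grad (f i) y))) (at y)"
      by (intro has_derivative_mult_right has_derivative_sum deriv)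
    then show ?thesis
      unfolding gderiv_def by (simp add: F[abs_def] inner_sum_right)
  qed
  have grad: "grad F = (\<lambda>y. c *\<^sub>R (\<Sum>i\<in>I. grad (f i) y))"
    by (rule ext) (rule grad_eqI[OF G])
  have H: "(grad F has_derivative (\<lambda>h. (c *\<^sub>R (\<Sum>i\<in>I. hessian (f i) y)) *v h)) (at y)" for y
  proof -
    have "(grad F has_derivative (\<lambda>h. c *\<^sub>R (\<Sum>i\<in>I. hessian (f i) y *v h))) (at y)"
      unfolding grad using f
      by (intro has_derivative_scaleR_right has_derivative_sum hessian_has_derivative)
    then show ?thesis
      by (simp add: sum_matrix_vector_mult scaleR_matrix_vector_assoc[symmetric])
  qed
  show "twice_differentiable F"
    unfolding twice_differentiable_def using G H by (auto simp: gderiv_def differentiable_def)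
  show "hessian F y = c *\<^sub>R (\<Sum>i\<in>I. hessian (f i) y)"
    by (rule hessian_eqI[OF H])
qed

text \<open>Taylor's formula along the segment. The Lagrange remainder asks only that the second
  derivative exists, which is what \<open>twice_differentiable\<close> provides.\<close>

lemma second_order_expansion:
  assumes "twice_differentiable F"
  obtains y where "F (x + v) = F x + v \<bullet> grad F x + (v \<bullet> (hessian F y *v v)) / 2"
proof -
  define d where "d m t = (if m = 0 then F (x + t *\<^sub>R v) else if m = Suc 0 then v \<bullet> grad F (x + t *\<^sub>R v)
    else v \<bullet> (hessian F (x + t *\<^sub>R v) *v v))" for m :: nat and t :: real
  have d: "d 0 = (\<lambda>t. F (x + t *\<^sub>R v))" "d 1 = (\<lambda>t. v \<bullet> grad F (x + t *\<^sub>R v))"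
    "d 2 = (\<lambda>t. v \<bullet> (hessian F (x + t *\<^sub>R v) *v v))"
    by (simp_all add: d_def fun_eq_iff)
  have line: "((\<lambda>t. x + t *\<^sub>R v) has_derivative (\<lambda>t. t *\<^sub>R v)) (at t)" for t
    by (auto intro!: derivative_eq_intros)
  have "(F has_derivative (\<lambda>h. h \<bullet> grad F (x + t *\<^sub>R v))) (at (x + t *\<^sub>R v))" for t
    using GDERIV_grad[of F] assms by (simp add: gderiv_def twice_differentiable_def)
  from has_derivative_compose[OF line this]
  have d0: "(d 0 has_real_derivative d 1 t) (at t)" for t
    unfolding d has_field_derivative_def by (simp add: mult.commute[of _ "_ \<bullet> _"])
  have "((\<lambda>t. v \<bullet> grad F (x + t *\<^sub>R v)) has_derivative (\<lambda>s. v \<bullet> (hessian F (x + t *\<^sub>R v) *v (s *\<^sub>R v)))) (at t)" for t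
    by (intro has_derivative_inner_right has_derivative_compose[OF line hessian_has_derivative[OF assms]])
  then have d1: "(d 1 has_real_derivative d 2 t) (at t)" for t
    unfolding d has_field_derivative_def
    by (simp add: matrix_vector_mult_scaleR mult.commute[of _ "_ \<bullet> _"])
  have "(d m has_real_derivative d (Suc m) t) (at t)" if "m < 2" for m t
    using d0[of t] d1[of t] less_2_cases[OF that] by (auto simp: numeral_2_eq_2)
  then have "\<exists>t. (if (1::real) < 0 then 1 < t \<and> t < 0 else 0 < t \<and> t < 1) \<and>
    d 0 1 = (\<Sum>m<2. d m 0 / fact m * (1 - 0) ^ m) + d 2 t / fact 2 * (1 - 0)\<^sup>2"
    by (intro Taylor[where a = 0 and b = 1]) auto
  then obtain t where "d 0 1 = (\<Sum>m<2. d m 0 / fact m * (1 - 0) ^ m) + d 2 t / fact 2 * (1 - 0)\<^sup>2"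
    by auto
  then have "F (x + v) = F x + v \<bullet> grad F x + (v \<bullet> (hessian F (x + t *\<^sub>R v) *v v)) / 2"
    by (simp add: d_def lessThan_nat_numeral numeral_2_eq_2)
  then show thesis by (rule that)
qed

text \<open>The Hessian bound gives a quadratic lower bound for F(x + v) - F(x); completing the
  square in \<open>v\<close> bounds it below uniformly.\<close>

lemma polyak_lojasiewicz:
  assumes "twice_differentiable F" and "\<gamma> > 0" and hess: "\<And>y. mat \<gamma> \<preceq> hessian F y"
  shows "F x - F z \<le> (norm (grad F x))\<^sup>2 / (2 * \<gamma>)"
proof -
  define v where "v = z - x"
  define g where "g = grad F x"
  obtain y where "F (x + v) = F x + v \<bullet> g + (v \<bullet> (hessian F y *v v)) / 2"
    unfolding g_def by (rule second_order_expansion[OF assms(1)])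
  moreover have "\<gamma> * (v \<bullet> v) \<le> v \<bullet> (hessian F y *v v)"
    by (rule loewner_le_matD(2)[OF hess])
  moreover have "0 \<le> (norm (\<gamma> *\<^sub>R v + g))\<^sup>2 / (2 * \<gamma>)" using \<open>\<gamma> > 0\<close> by simp
  moreover have "(norm (\<gamma> *\<^sub>R v + g))\<^sup>2 / (2 * \<gamma>) = \<gamma> * (v \<bullet> v) / 2 + v \<bullet> g + (norm g)\<^sup>2 / (2 * \<gamma>)"
    unfolding power2_norm_eq_inner using \<open>\<gamma> > 0\<close>
    by (simp add: inner_add_left inner_add_right inner_commute field_simps)
  ultimately show ?thesis by (simp add: v_def g_def)
qed

subsection \<open>Spectral regularization\<close>

lemma outer_mult_vector: "outer u w *v y = (w \<bullet> y) *\<^sub>R u"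
  by (simp add: outer_def matrix_matrix_mult_def matrix_vector_mult_def columnvector_def rowvector_def
      vec_eq_iff inner_vec_def sum_distrib_left mult_ac)

text \<open>The basis handed out is the one that witnesses the choice in
  \<open>spectral_reg\<close>; \<open>symmetric_eigensystem\<close> only shows that the choice is
  from a nonempty collection.\<close>

lemma eigensystem_spectral_reg:
  fixes H :: "real^'p^'p"
  assumes "transpose H = H"
  obtains v \<mu> where "eigensystem H v \<mu>" "eigensystem (spectral_reg l H) v (\<lambda>i. max (\<mu> i) l)"
proof -
  define P where "P X \<longleftrightarrow> (\<exists>(v :: 'p \<Rightarrow> real^'p) (\<mu> :: 'p \<Rightarrow> real).
      (\<forall>i j. v i \<bullet> v j = (if i = j then 1 else 0)) \<and>
      (\<forall>i. H *v v i = \<mu> i *\<^sub>R v i) \<and>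
      X = (\<Sum>i\<in>UNIV. max (\<mu> i) l *\<^sub>R outer (v i) (v i)))" for X
  obtain v \<mu> where "eigensystem H v \<mu>" using symmetric_eigensystem[OF assms] .
  then have "\<exists>X. P X" unfolding P_def eigensystem_def by blast
  then have "P (spectral_reg l H)"
    unfolding spectral_reg_def P_def by (rule someI_ex)
  then obtain v \<mu> where v: "eigensystem H v \<mu>"
    and X: "spectral_reg l H = (\<Sum>i\<in>UNIV. max (\<mu> i) l *\<^sub>R outer (v i) (v i))"
    unfolding P_def eigensystem_def by blast
  have "spectral_reg l H *v v i = max (\<mu> i) l *\<^sub>R v i" for i
  proof -
    have "spectral_reg l H *v v i = (\<Sum>j\<in>UNIV. if j = i then max (\<mu> i) l *\<^sub>R v i else 0)"
      unfolding X sum_matrix_vector_mult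
      by (intro sum.cong refl)
        (simp add: scaleR_matrix_vector_assoc[symmetric] outer_mult_vector eigensystemD(1)[OF v])
    then show ?thesis by simp
  qed
  then have "eigensystem (spectral_reg l H) v (\<lambda>i. max (\<mu> i) l)"
    using v by (simp add: eigensystem_def)
  with v that show thesis by blast
qed

text \<open>In the eigenbasis - d.g is the sum of (G^2 - R G) / h over the coordinates, with
  \<open>R\<close> those of the residual. Young's inequality leaves (3/4 G^2 - R^2) / h; the first
  term is bounded through h <= L, the second through h >= l. The tolerance limits the total residual
  part to a quarter of |g|^2 / L, and 3/4 - 1/4 = 1/2.\<close>

lemma inexact_newton_descent:
  fixes M :: "real^'p^'p"
  assumes E: "eigensystem M v h" and h: "\<And>i. l \<le> h i" "\<And>i. h i \<le> L" "0 < l"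
    and res: "norm (M *v d + g) \<le> \<theta> * norm g" and \<theta>: "0 \<le> \<theta>" "\<theta> \<le> 1 / 2 * sqrt (l / L)"
  shows "(norm g)\<^sup>2 / (2 * L) \<le> - (d \<bullet> g)"
proof -
  have hpos: "0 < h i" for i using h(1)[of i] h(3) by linarith
  have L: "l \<le> L" using h(1,2) order_trans by blast
  define r where "r = M *v d + g"
  define G where "G i = v i \<bullet> g" for i
  define R where "R i = v i \<bullet> r" for i
  have coord: "h i * (v i \<bullet> d) = R i - G i" for i
    using eigensystem_dot[OF E, of i d] by (simp add: R_def G_def r_def inner_add_right)
  have summand: "3 / 4 / L * (G i)\<^sup>2 - 1 / l * (R i)\<^sup>2 \<le> - ((v i \<bullet> d) * G i)" for i
  proof -
    have d: "v i \<bullet> d = (R i - G i) / h i" using coord[of i] hpos[of i] by (simp add: field_simps)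
    have "R i * G i \<le> (G i)\<^sup>2 / 4 + (R i)\<^sup>2"
      using zero_le_power2[of "G i / 2 - R i"] by (simp add: power2_diff power_divide algebra_simps)
    then have "(3 / 4 * (G i)\<^sup>2 - (R i)\<^sup>2) / h i \<le> ((G i)\<^sup>2 - R i * G i) / h i"
      using hpos[of i] by (intro divide_right_mono) auto
    moreover have "((G i)\<^sup>2 - R i * G i) / h i = - ((v i \<bullet> d) * G i)"
      by (simp add: d power2_eq_square minus_divide_left algebra_simps)
    moreover have "3 / 4 * (G i)\<^sup>2 / L \<le> 3 / 4 * (G i)\<^sup>2 / h i"
      using hpos[of i] h(2)[of i] by (intro divide_left_mono mult_pos_pos) auto
    moreover have "(R i)\<^sup>2 / h i \<le> (R i)\<^sup>2 / l"
      using h(1)[of i] h(3) hpos[of i] by (intro divide_left_mono mult_pos_pos) auto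
    ultimately show ?thesis by (simp add: diff_divide_distrib)
  qed
  have "(norm r)\<^sup>2 \<le> (\<theta> * norm g)\<^sup>2" using res unfolding r_def by (intro power_mono) auto
  also have "\<dots> \<le> (1 / 2 * sqrt (l / L))\<^sup>2 * (norm g)\<^sup>2"
    unfolding power_mult_distrib[of \<theta>] using \<theta> by (intro mult_right_mono power_mono) auto
  also have "(1 / 2 * sqrt (l / L))\<^sup>2 = l / (4 * L)"
    using h(3) L by (simp add: power_mult_distrib power2_eq_square)
  finally have "(norm r)\<^sup>2 / l \<le> (norm g)\<^sup>2 / (4 * L)"
    using h(3) L by (simp add: field_simps)
  then have "(norm g)\<^sup>2 / (2 * L) \<le> 3 / 4 / L * (norm g)\<^sup>2 - 1 / l * (norm r)\<^sup>2"
    using h(3) L by (simp add: field_simps)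
  also have "\<dots> = (\<Sum>i\<in>UNIV. 3 / 4 / L * (G i)\<^sup>2 - 1 / l * (R i)\<^sup>2)"
    by (simp only: eigensystem_norm[OF E] sum_subtractf sum_distrib_left G_def R_def)
  also have "\<dots> \<le> (\<Sum>i\<in>UNIV. - ((v i \<bullet> d) * G i))"
    by (intro sum_mono summand)
  also have "\<dots> = - (d \<bullet> g)"
    by (simp add: parseval[OF E, of d g] sum_negf G_def)
  finally show ?thesis .
qed

subsection \<open>Averages of the largest elements\<close>

text \<open>With the q-th largest entry (index q - 1) as threshold, the leading entries contribute
  their excess and the others nothing. The sum of excesses does not depend on the order of the
  list.\<close>

lemma sum_list_take_eq:
  fixes xs :: "real list"
  assumes "sorted (rev xs)" "0 < q" "q \<le> length xs"
  shows "sum_list (take q xs) = real q * xs ! (q - 1) + (\<Sum>x\<leftarrow>xs. max (x - xs ! (q - 1)) 0)"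
proof -
  define t where "t = xs ! (q - 1)"
  have mono: "xs ! j \<le> xs ! i" if "i \<le> j" "j < length xs" for i j
    using assms(1) that by (simp add: sorted_rev_nth_mono)
  have large: "t \<le> x" if "x \<in> set (take q xs)" for x
    using that assms mono by (auto simp: t_def in_set_conv_nth)
  have small: "x \<le> t" if "x \<in> set (drop q xs)" for x
    using that assms mono by (auto simp: t_def in_set_conv_nth)
  have "(\<Sum>x\<leftarrow>xs. max (x - t) 0) = (\<Sum>x\<leftarrow>take q xs. max (x - t) 0) + (\<Sum>x\<leftarrow>drop q xs. max (x - t) 0)"
    by (metis append_take_drop_id map_append sum_list_append)
  also have "map (\<lambda>x. max (x - t) 0) (take q xs) = map (\<lambda>x. x - t) (take q xs)"
    using large by (intro map_cong) auto
  also have "map (\<lambda>x. max (x - t) 0) (drop q xs) = map (\<lambda>x. 0) (drop q xs)"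
    using small by (intro map_cong) auto
  finally have "(\<Sum>x\<leftarrow>xs. max (x - t) 0) = sum_list (take q xs) - real q * t"
    using assms(3) by (simp add: sum_list_subtractf sum_list_triv min_absorb2)
  then show ?thesis by (simp add: t_def)
qed

text \<open>Each term is at most the threshold \<open>t\<close> plus its positive excess. Extending
  the excesses from \<open>S\<close> to all indices gives a quantity of the multiset alone, hence of
  the sorted list.\<close>

lemma sum_le_top_avg:
  assumes S: "S \<subseteq> {1..n}" "card S = s" "0 < s"
  shows "(\<Sum>i\<in>S. c i) \<le> real s * top_avg n c s"
proof -
  define xs where "xs = rev (sort (map c [1..<Suc n]))"
  define t where "t = xs ! (s - 1)"
  have s: "s \<le> n" using card_mono[OF _ S(1)] S(2) by simp
  have "(\<Sum>i\<in>S. c i) = real s * t + (\<Sum>i\<in>S. c i - t)" using S by (simp add: sum_subtractf)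
  also have "(\<Sum>i\<in>S. c i - t) \<le> (\<Sum>i\<in>S. max (c i - t) 0)" by (intro sum_mono) auto
  also have "\<dots> \<le> (\<Sum>i=1..n. max (c i - t) 0)" by (intro sum_mono2 S) auto
  also have "\<dots> = (\<Sum>x\<leftarrow>map c [1..<Suc n]. max (x - t) 0)"
    by (simp add: interv_sum_list_conv_sum_set_nat o_def atLeastLessThanSuc_atLeastAtMost del: upt_Suc)
  also have "\<dots> = (\<Sum>x\<leftarrow>xs. max (x - t) 0)"
  proof -
    have "mset (map c [1..<Suc n]) = mset xs" by (simp add: xs_def del: upt_Suc)
    then show ?thesis by (simp only: sum_mset_sum_list[symmetric] mset_map)
  qed
  also have "real s * t + (\<Sum>x\<leftarrow>xs. max (x - t) 0) = sum_list (take s xs)"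
    unfolding t_def using S s by (intro sum_list_take_eq[symmetric]) (auto simp: xs_def simp del: upt_Suc)
  finally show ?thesis using S by (simp add: top_avg_def xs_def del: upt_Suc)
qed

subsection \<open>One iteration\<close>

lemma sub_hessian_bounds:
  fixes f :: "nat \<Rightarrow> real^'p \<Rightarrow> real"
  assumes f: "\<And>i. i \<in> {1..n} \<Longrightarrow> 0 \<preceq> hessian (f i) y \<and> hessian (f i) y \<preceq> mat (c i)"
    and S: "S \<in> samples n s" and s: "0 < s"
  shows "psd (sub_hessian f S y)"
    and "v \<bullet> (sub_hessian f S y *v v) \<le> top_avg n c s * (v \<bullet> v)"
proof -
  have SI: "S \<subseteq> {1..n}" "card S = s" using S by (auto simp: samples_def)
  have f': "psd (hessian (f i) y)" "u \<bullet> (hessian (f i) y *v u) \<le> c i * (u \<bullet> u)" if "i \<in> S" for i u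
  proof -
    have i: "i \<in> {1..n}" using SI that by auto
    then show "psd (hessian (f i) y)" using f by simp
    show "u \<bullet> (hessian (f i) y *v u) \<le> c i * (u \<bullet> u)"
      using f[OF i] by (intro loewner_le_matD) simp
  qed
  have quad: "u \<bullet> (sub_hessian f S y *v u) = (\<Sum>j\<in>S. u \<bullet> (hessian (f j) y *v u)) / real s" for u
    by (simp add: sub_hessian_def SI sum_matrix_vector_mult inner_sum_right
        scaleR_matrix_vector_assoc[symmetric])
  have "transpose (sub_hessian f S y) = sub_hessian f S y"
    unfolding sub_hessian_def transpose_scalar transpose_sum
    using f' by (intro arg_cong[where f = "scaleR _"] sum.cong refl psd_symmetric)
  then show "psd (sub_hessian f S y)"
    unfolding psd_def quad using f' by (auto intro!: divide_nonneg_nonneg sum_nonneg psd_nonneg)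
  have "(\<Sum>j\<in>S. v \<bullet> (hessian (f j) y *v v)) \<le> (\<Sum>j\<in>S. c j) * (v \<bullet> v)"
    unfolding sum_distrib_right by (intro sum_mono f')
  also have "\<dots> \<le> (real s * top_avg n c s) * (v \<bullet> v)"
    by (intro mult_right_mono sum_le_top_avg SI s) auto
  finally show "v \<bullet> (sub_hessian f S y *v v) \<le> top_avg n c s * (v \<bullet> v)"
    unfolding quad using s by (simp add: field_simps)
qed

lemma newton_iteration_reduction:
  fixes f :: "nat \<Rightarrow> real^'p \<Rightarrow> real"
  assumes F: "twice_differentiable F" "\<And>y. mat \<gamma> \<preceq> hessian F y" "0 < \<gamma>"
    and H: "psd (sub_hessian f S x)" "\<And>v. v \<bullet> (sub_hessian f S x *v v) \<le> m * (v \<bullet> v)"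
    and it: "newton_iteration f F \<theta>\<^sub>2 \<beta> \<alpha>max x S l \<theta>\<^sub>1 d \<alpha> x'"
    and par: "0 < \<beta>" "0 \<le> \<alpha>max" and tol: "\<theta>\<^sub>1 \<le> 1 / 2 * sqrt (l / max l m)"
  shows "F x' - F z \<le> (1 - \<alpha> * \<beta> * \<gamma> / max m l) * (F x - F z)"
proof -
  define g where "g = grad F x"
  define L where "L = max m l"
  obtain v \<mu> where v: "eigensystem (sub_hessian f S x) v \<mu>"
      "eigensystem (spectral_reg l (sub_hessian f S x)) v (\<lambda>i. max (\<mu> i) l)"
    using eigensystem_spectral_reg[OF psd_symmetric[OF H(1)]] .
  have \<mu>: "0 \<le> \<mu> i" "\<mu> i \<le> m" for i
    using psd_nonneg[OF H(1), of "v i"] H(2)[of "v i"] eigensystemD(1)[OF v(1), of i i]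
    by (simp_all add: eigensystem_value[OF v(1)])
  \<comment> \<open>The threshold exceeds \<open>lambda_min\<close>, which is nonnegative for a
    positive semidefinite matrix.\<close>
  have l: "0 < l"
    using it \<mu>(1) eigensystem_lambda_min_mem[OF v(1)]
    by (metis le_less_trans newton_iteration_def)
  have max_le: "max (\<mu> i) l \<le> L" for i
    using \<mu>(2)[of i] unfolding L_def by (rule max.mono) simp
  \<comment> \<open>Step size 0 always passes the Armijo test, and \<alpha> is the largest that
    does.\<close>
  have \<alpha>: "0 \<le> \<alpha>"
    using it par by (auto simp: newton_iteration_def Let_def armijo_def)
  have L: "0 < L" using l by (simp add: L_def)
  have "(norm g)\<^sup>2 / (2 * L) \<le> - (d \<bullet> g)"
    using it tol l by (intro inexact_newton_descent[OF v(2) _ max_le, of l d g \<theta>\<^sub>1])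
      (auto simp: newton_iteration_def Let_def g_def L_def max.commute)
  moreover have "F x - F z \<le> (norm g)\<^sup>2 / (2 * \<gamma>)"
    unfolding g_def by (rule polyak_lojasiewicz[OF F(1,3,2)])
  then have "\<gamma> / L * (F x - F z) \<le> \<gamma> / L * ((norm g)\<^sup>2 / (2 * \<gamma>))"
    using L F(3) by (intro mult_left_mono) auto
  moreover have "\<gamma> / L * ((norm g)\<^sup>2 / (2 * \<gamma>)) = (norm g)\<^sup>2 / (2 * L)"
    using F(3) by simp
  ultimately have "d \<bullet> g \<le> - (\<gamma> / L * (F x - F z))" by linarith
  then have "\<alpha> * \<beta> * (d \<bullet> g) \<le> \<alpha> * \<beta> * - (\<gamma> / L * (F x - F z))"
    using \<alpha> par by (intro mult_left_mono) auto
  moreover have "F x' \<le> F x + \<alpha> * \<beta> * (d \<bullet> g)"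
    using it by (simp add: newton_iteration_def Let_def armijo_def g_def)
  ultimately show ?thesis by (simp add: L_def algebra_simps)
qed

text \<open>The second-order term along \<open>a *\<^sub>R d\<close> is at most a^2 K |d|^2 / 2,
  while the curvature condition gives - d.g >= (1 - \<open>\<theta>\<^sub>2\<close>) m |d|^2.
  Comparing them shows that the claimed step passes the Armijo test, so the largest passing step is
  no smaller.\<close>

lemma newton_iteration_step_size:
  fixes f :: "nat \<Rightarrow> real^'p \<Rightarrow> real"
  assumes F: "twice_differentiable F" "\<And>y. hessian F y \<preceq> mat K" "0 < K"
    and H: "transpose (sub_hessian f S x) = sub_hessian f S x"
      "\<And>v. m * (v \<bullet> v) \<le> v \<bullet> (sub_hessian f S x *v v)" "0 \<le> m"
    and it: "newton_iteration f F \<theta>\<^sub>2 \<beta> \<alpha>max x S l \<theta>\<^sub>1 d \<alpha> x'"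
    and par: "\<theta>\<^sub>2 \<le> 1" "\<beta> \<le> 1" "0 \<le> \<alpha>max"
  shows "min \<alpha>max (2 * (1 - \<theta>\<^sub>2) * (1 - \<beta>) * m / K) \<le> \<alpha>"
proof -
  define g where "g = grad F x"
  define a where "a = min \<alpha>max (2 * (1 - \<theta>\<^sub>2) * (1 - \<beta>) * m / K)"
  have a: "0 \<le> a" using par F(3) H(3) by (simp add: a_def)
  obtain v \<mu> where v: "eigensystem (sub_hessian f S x) v \<mu>"
      "eigensystem (spectral_reg l (sub_hessian f S x)) v (\<lambda>i. max (\<mu> i) l)"
    using eigensystem_spectral_reg[OF H(1)] .
  have \<mu>: "m \<le> \<mu> i" for i
    using H(2)[of "v i"] eigensystemD(1)[OF v(1), of i i]
    by (simp add: eigensystem_value[OF v(1)])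
  \<comment> \<open>Regularization only raises eigenvalues, so the lower bound survives.\<close>
  have reg: "m * (d \<bullet> d) \<le> d \<bullet> (spectral_reg l (sub_hessian f S x) *v d)"
  proof -
    have "m * (d \<bullet> d) = (\<Sum>i\<in>UNIV. m * (v i \<bullet> d)\<^sup>2)"
      by (simp add: eigensystem_norm[OF v(1)] sum_distrib_left dot_square_norm)
    also have "\<dots> \<le> (\<Sum>i\<in>UNIV. max (\<mu> i) l * (v i \<bullet> d)\<^sup>2)"
      using \<mu> by (intro sum_mono mult_right_mono) (auto simp: le_max_iff_disj)
    finally show ?thesis by (simp add: eigensystem_quadratic[OF v(2)])
  qed
  have slope: "(1 - \<theta>\<^sub>2) * (m * (d \<bullet> d)) \<le> - (d \<bullet> g)"
  proof -
    have "(1 - \<theta>\<^sub>2) * (m * (d \<bullet> d)) \<le> (1 - \<theta>\<^sub>2) * (d \<bullet> (spectral_reg l (sub_hessian f S x) *v d))"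
      using reg par by (intro mult_left_mono) auto
    also have "\<dots> \<le> - (d \<bullet> g)"
      using it by (simp add: newton_iteration_def Let_def g_def algebra_simps)
    finally show ?thesis .
  qed
  have "armijo F \<beta> x d a"
  proof -
    obtain y where "F (x + a *\<^sub>R d) = F x + (a *\<^sub>R d) \<bullet> g + ((a *\<^sub>R d) \<bullet> (hessian F y *v (a *\<^sub>R d))) / 2"
      unfolding g_def by (rule second_order_expansion[OF F(1)])
    moreover have "(a *\<^sub>R d) \<bullet> (hessian F y *v (a *\<^sub>R d)) \<le> K * ((a *\<^sub>R d) \<bullet> (a *\<^sub>R d))"
      by (rule loewner_le_matD(1)[OF F(2)])
    ultimately have "F (x + a *\<^sub>R d) \<le> F x + a * (d \<bullet> g) + a * (a * K / 2 * (d \<bullet> d))"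
      by (simp add: mult_ac)
    also have "a * (a * K / 2 * (d \<bullet> d)) \<le> a * ((1 - \<beta>) * - (d \<bullet> g))"
    proof (intro mult_left_mono a)
      have "a \<le> 2 * ((1 - \<theta>\<^sub>2) * (1 - \<beta>) * m) / K"
        unfolding a_def mult.assoc by (rule min.cobounded2)
      then have "a * K \<le> 2 * ((1 - \<theta>\<^sub>2) * (1 - \<beta>) * m)" by (simp only: pos_le_divide_eq[OF F(3)])
      then have "a * K / 2 * (d \<bullet> d) \<le> (1 - \<theta>\<^sub>2) * (1 - \<beta>) * m * (d \<bullet> d)"
        by (intro mult_right_mono) auto
      also have "\<dots> = (1 - \<beta>) * ((1 - \<theta>\<^sub>2) * (m * (d \<bullet> d)))" by (simp only: mult_ac)
      also have "\<dots> \<le> (1 - \<beta>) * - (d \<bullet> g)" using par by (intro mult_left_mono slope) auto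
      finally show "a * K / 2 * (d \<bullet> d) \<le> (1 - \<beta>) * - (d \<bullet> g)" .
    qed
    finally show ?thesis by (simp add: armijo_def g_def algebra_simps)
  qed
  moreover have "a \<le> \<alpha>max" by (simp add: a_def)
  ultimately show ?thesis
    using it by (simp add: newton_iteration_def Let_def a_def)
qed

text \<open>The free choices of the iteration are quantified inside the event, so they may depend on
  the drawn sample. The step-size bound is capped at \<alpha>max because the quotient can come close
  to 2, whereas \<alpha>max may be 1.\<close>

theorem corollary1:
  fixes f :: "nat \<Rightarrow> real^'p \<Rightarrow> real" and F :: "real^'p \<Rightarrow> real"
    and Ki :: "nat \<Rightarrow> real" and K \<gamma> \<epsilon> \<delta> \<theta>\<^sub>2 \<beta> \<alpha>max :: real
    and n s :: nat and x xstar :: "real^'p"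
  assumes F: "\<And>y. F y = (1 / real n) * (\<Sum>i=1..n. f i y)"
    and diff: "\<And>i. i \<in> {1..n} \<Longrightarrow> twice_differentiable (f i)"
    and Ki_pos: "\<And>i. i \<in> {1..n} \<Longrightarrow> 0 < Ki i"
    and hess_f: "\<And>i y. i \<in> {1..n} \<Longrightarrow> 0 \<preceq> hessian (f i) y \<and> hessian (f i) y \<preceq> mat (Ki i)"
    and gamma: "0 < \<gamma>" "\<gamma> \<le> K"
    and hess_F: "\<And>y. mat \<gamma> \<preceq> hessian F y \<and> hessian F y \<preceq> mat K"
    and xstar: "\<And>y. F xstar \<le> F y"
    and eps: "0 < \<epsilon>" "\<epsilon> < 1"
    and delta: "0 < \<delta>" "\<delta> < 1"
    and theta2: "0 < \<theta>\<^sub>2" "\<theta>\<^sub>2 < 1"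
    and beta: "0 < \<beta>" "\<beta> < 1"
    and alphamax: "1 \<le> \<alpha>max"
    and sample_size: "1 \<le> s" "s \<le> n"
      "real s \<ge> 2 * (top_avg n Ki 1 / \<gamma>) * ln (real CARD('p) / \<delta>) / \<epsilon>\<^sup>2"
  shows "(\<forall>S \<in> samples n s. \<forall>l \<theta>\<^sub>1 d \<alpha> x'.
            newton_iteration f F \<theta>\<^sub>2 \<beta> \<alpha>max x S l \<theta>\<^sub>1 d \<alpha> x' \<and>
            \<theta>\<^sub>1 \<le> 1 / 2 * sqrt (l / max l (top_avg n Ki s)) \<longrightarrow>
            F x' - F xstar
              \<le> (1 - \<alpha> * \<beta> * \<gamma> / max (top_avg n Ki s) l) * (F x - F xstar))
       \<and> measure_pmf.prob (pmf_of_set (samples n s))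
           {S. \<forall>l \<theta>\<^sub>1 d \<alpha> x'.
              newton_iteration f F \<theta>\<^sub>2 \<beta> \<alpha>max x S l \<theta>\<^sub>1 d \<alpha> x' \<and>
              \<theta>\<^sub>1 \<le> 1 / 2 * sqrt (l / max l (top_avg n Ki s)) \<longrightarrow>
              \<alpha> \<ge> min \<alpha>max (2 * (1 - \<theta>\<^sub>2) * (1 - \<beta>) * (1 - \<epsilon>) / (K / \<gamma>))}
         \<ge> 1 - \<delta>"
proof -
  \<comment> \<open>The average of the single largest bound, that is, the maximum of the
    \<open>Ki i\<close>.\<close>
  define R where "R = top_avg n Ki 1"
  have n: "n > 0" using sample_size by simp
  have avg: "twice_differentiable F" "hessian F y = (1 / real n) *\<^sub>R (\<Sum>i=1..n. hessian (f i) y)" for y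
    using average_twice_differentiable[of F "1 / real n" f "{1..n}", OF F diff] by auto
  have Ki_R: "Ki i \<le> R" if "i \<in> {1..n}" for i
    using sum_le_top_avg[of "{i}" n 1 Ki] that by (simp add: R_def)
  have R: "R > 0" using Ki_pos[of 1] Ki_R[of 1] n by simp
  have sub: "psd (sub_hessian f S x)"
      "v \<bullet> (sub_hessian f S x *v v) \<le> top_avg n Ki s * (v \<bullet> v)" if "S \<in> samples n s" for S v
    using sub_hessian_bounds[OF hess_f that] sample_size by auto
  \<comment> \<open>This event concerns the Hessians at \<open>x\<close> only, not the choices made
    by the iteration.\<close>
  define bad where "bad = {S. \<exists>v. v \<bullet> ((\<Sum>j\<in>S. hessian (f j) x) *v v) < real s * (1 - \<epsilon>) * \<gamma> * (v \<bullet> v)}"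
  define good where "good = {S. \<forall>l \<theta>\<^sub>1 d \<alpha> x'.
              newton_iteration f F \<theta>\<^sub>2 \<beta> \<alpha>max x S l \<theta>\<^sub>1 d \<alpha> x' \<and>
              \<theta>\<^sub>1 \<le> 1 / 2 * sqrt (l / max l (top_avg n Ki s)) \<longrightarrow>
              \<alpha> \<ge> min \<alpha>max (2 * (1 - \<theta>\<^sub>2) * (1 - \<beta>) * (1 - \<epsilon>) / (K / \<gamma>))}"
  have good: "S \<in> good" if S: "S \<in> samples n s" "S \<notin> bad" for S
  proof -
    have lower: "(1 - \<epsilon>) * \<gamma> * (v \<bullet> v) \<le> v \<bullet> (sub_hessian f S x *v v)" for v
    proof -
      have "real s * ((1 - \<epsilon>) * \<gamma> * (v \<bullet> v)) \<le> v \<bullet> ((\<Sum>j\<in>S. hessian (f j) x) *v v)"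
        using S(2) by (auto simp: bad_def not_less mult.assoc)
      then show ?thesis
        using S(1) sample_size
        by (simp add: sub_hessian_def samples_def scaleR_matrix_vector_assoc[symmetric] field_simps)
    qed
    have "min \<alpha>max (2 * (1 - \<theta>\<^sub>2) * (1 - \<beta>) * (1 - \<epsilon>) / (K / \<gamma>)) \<le> \<alpha>"
      if "newton_iteration f F \<theta>\<^sub>2 \<beta> \<alpha>max x S l \<theta>\<^sub>1 d \<alpha> x'" for l \<theta>\<^sub>1 d \<alpha> x'
    proof -
      have "min \<alpha>max (2 * (1 - \<theta>\<^sub>2) * (1 - \<beta>) * ((1 - \<epsilon>) * \<gamma>) / K) \<le> \<alpha>"
        using hess_F gamma eps theta2 beta alphamax
        by (intro newton_iteration_step_size[OF avg(1) _ _ psd_symmetric[OF sub(1)[OF S(1)]] lower _ that]) auto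
      then show ?thesis by (simp add: mult.assoc)
    qed
    then show ?thesis unfolding good_def by blast
  qed
  have "measure_pmf.prob (pmf_of_set (samples n s)) bad
      \<le> real CARD('p) * exp (- (real s * \<gamma> * \<epsilon>\<^sup>2 / (2 * R)))"
    unfolding bad_def
  proof (rule matrix_chernoff_without_replacement[where H = "\<lambda>j. hessian (f j) x" and n = n])
    show "psd (hessian (f j) x)" if "j \<in> {1..n}" for j using hess_f[OF that] by simp
    show "v \<bullet> (hessian (f j) x *v v) \<le> R * (v \<bullet> v)" if "j \<in> {1..n}" for j v
    proof -
      have "v \<bullet> (hessian (f j) x *v v) \<le> Ki j * (v \<bullet> v)"
        using hess_f[OF that] by (intro loewner_le_matD) simp
      also have "\<dots> \<le> R * (v \<bullet> v)" by (intro mult_right_mono Ki_R that) auto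
      finally show ?thesis .
    qed
    show "real n * \<gamma> * (v \<bullet> v) \<le> v \<bullet> ((\<Sum>j=1..n. hessian (f j) x) *v v)" for v
    proof -
      have "\<gamma> * (v \<bullet> v) \<le> v \<bullet> (hessian F x *v v)"
        using hess_F by (intro loewner_le_matD) simp
      then show ?thesis
        using n by (simp add: avg(2) scaleR_matrix_vector_assoc[symmetric] field_simps)
    qed
  qed (use R gamma eps sample_size n in auto)
  also have "\<dots> \<le> \<delta>"
  proof -
    \<comment> \<open>The sample size is exactly what makes the Chernoff exponent reach ln (p /
      \<delta>).\<close>
    have "2 * (R / \<gamma>) * ln (real CARD('p) / \<delta>) / \<epsilon>\<^sup>2 * (\<gamma> * \<epsilon>\<^sup>2 / (2 * R)) \<le> real s * (\<gamma> * \<epsilon>\<^sup>2 / (2 * R))"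
      using sample_size(3) gamma R by (intro mult_right_mono) (auto simp: R_def)
    moreover have "2 * (R / \<gamma>) * ln (real CARD('p) / \<delta>) / \<epsilon>\<^sup>2 * (\<gamma> * \<epsilon>\<^sup>2 / (2 * R)) = ln (real CARD('p) / \<delta>)"
      using gamma R eps by simp
    ultimately have "exp (- (real s * \<gamma> * \<epsilon>\<^sup>2 / (2 * R))) \<le> exp (- ln (real CARD('p) / \<delta>))"
      by (simp add: mult.assoc)
    also have "\<dots> = \<delta> / real CARD('p)" using delta by (simp add: exp_minus)
    finally show ?thesis by (simp add: field_simps)
  qed
  finally have bad: "measure_pmf.prob (pmf_of_set (samples n s)) bad \<le> \<delta>" .
  have "samples n s \<noteq> {}"
    using card_samples[of n s] sample_size by (metis card.empty binomial_eq_0_iff not_le)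
  then have supp: "set_pmf (pmf_of_set (samples n s)) = samples n s"
    by (simp add: finite_samples)
  have "1 - measure_pmf.prob (pmf_of_set (samples n s)) bad
      = measure_pmf.prob (pmf_of_set (samples n s)) (- bad)"
    by (simp add: measure_pmf.prob_compl[symmetric] Compl_eq_Diff_UNIV)
  \<comment> \<open>Restriction to the support: \<open>good\<close> was derived for genuine samples
    only.\<close>
  also have "\<dots> = measure_pmf.prob (pmf_of_set (samples n s)) (- bad \<inter> samples n s)"
    using measure_Int_set_pmf[of "pmf_of_set (samples n s)" "- bad"] by (simp add: supp)
  also have "\<dots> \<le> measure_pmf.prob (pmf_of_set (samples n s)) good"
    using good by (intro measure_pmf.finite_measure_mono) auto
  finally have "1 - \<delta> \<le> measure_pmf.prob (pmf_of_set (samples n s)) good" using bad by simp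
  moreover have "F x' - F xstar \<le> (1 - \<alpha> * \<beta> * \<gamma> / max (top_avg n Ki s) l) * (F x - F xstar)"
    if "S \<in> samples n s" "newton_iteration f F \<theta>\<^sub>2 \<beta> \<alpha>max x S l \<theta>\<^sub>1 d \<alpha> x'"
      "\<theta>\<^sub>1 \<le> 1 / 2 * sqrt (l / max l (top_avg n Ki s))" for S l \<theta>\<^sub>1 d \<alpha> x'
    using that hess_F gamma beta alphamax
    by (intro newton_iteration_reduction[OF avg(1) _ _ sub(1) sub(2), of _ S]) auto
  ultimately show ?thesis unfolding good_def by blast
qed

end
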